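(* Let $H$ be a prime connected ribbon hypermap. Then ${}^{\partial}\varepsilon_{H}(z)=k$ for some integer $k$ (i.e. the partial-dual polynomial is constant) if and only if $H$ is a plane ribbon hypermap with $e(H)=1$.
   Context: A ribbon hypermap $H$ is a (possibly non-orientable) surface with boundary, written as the union of two sets of discs, the hypervertices $V(H)$ and the hyperedges $E(H)$, such that hypervertices and hyperedges meet in disjoint line segments (common line segments), each lying on the boundary of exactly one hypervertex and exactly one hyperedge. Hyperfaces are the boundary components of the surface. $v(H),e(H),f(H),k(H)$ are the numbers of hypervertices, hyperedges, hyperfaces and connected components; $d(e)$ is the number of common line segments on hyperedge $e$ and $d(H)=\sum_e d(e)$. The Euler genus is $\varepsilon(H)=2k(H)+d(H)-v(H)-e(H)-f(H)$. $H$ is plane if it is connected and $\varepsilon(H)=0$. For $A\subseteq E(H)$, the sub-ribbon hypermap $A$ is obtained by deleting all hyperedges not in $A$ while keeping all hypervertices. Partial dual $H^A$ ($A\subseteq E(H)$): in an arrow presentation of $H$ (hypervertices as closed curves; each hyperedge $e$ as arrows $e_1,\dots,e_{d(e)}$ along its common line segments in cyclic order around $e$), for each $e\in A$ and each $i$ draw a new arrow from the head of $e_i$ to the tail of $e_{i+1}$ (indices mod $d(e)$), label it $e_i$, and delete the original arrows; the new arrows become arcs of the closed curves of the arrow presentation of $H^A$ (equivalently, the hypervertices of $H^A$ are the boundary components of the sub-ribbon hypermap $A$, and the hyperedges are unchanged). The partial-dual polynomial is ${}^{\partial}\varepsilon_{H}(z)=\sum_{A\subseteq E(H)} z^{\varepsilon(H^A)}$.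 One-vertex-joint $H_1\vee H_2$ of disjoint ribbon hypermaps: choose an arc on the boundary of a hypervertex of $H_1$ lying between two consecutive hyperedge ends, and a similar arc on a hypervertex of $H_2$, and paste the two hypervertices together by identifying these arcs. $H$ is prime if there do not exist non-empty sub-ribbon hypermaps $H_1,\dots,H_k$ of $H$ with $k\ge 2$ and $H=H_1\vee\cdots\vee H_k$.
   Formalization: H is assumed to have at least one hyperedge (a single isolated hypervertex is prime, connected, with constant polynomial 1 but e(H)=0), and every hyperedge has d(e) ≥ 1, since the two descriptions of H^A disagree when d(e)=0. *)

theory Defs
  imports Main "HOL-Combinatorics.Permutations" "HOL-Computational_Algebra.Polynomial"
begin

text \<open>
  Ribbon hypermaps are given by arrow presentations. There is one arrow for each common line
  segment. The arrows on a hyperedge all point the same way around its boundary, and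
  \<open>next_arrow\<close> sends each of them to the following one, so the hyperedges are the cycles
  of \<open>next_arrow\<close> and a hyperedge has at least one common line segment. Removing the arrows
  from the closed curves bounding the hypervertices leaves arcs, and \<open>curve_arc\<close> exchanges
  the two ends of each arc; traversing a curve may meet arrows in either direction, which is
  how non-orientable surfaces arise. Hypervertices that meet no hyperedge carry no
  arrows and are only counted, by \<open>bare_curves\<close>.
\<close>

datatype 'a arrow_end = Tail 'a | Head 'a

primrec other_end :: "'a arrow_end \<Rightarrow> 'a arrow_end" where
  "other_end (Tail a) = Head a"
| "other_end (Head a) = Tail a"

definition ends_of :: "'a set \<Rightarrow> 'a arrow_end set" where
  "ends_of B = Tail ` B \<union> Head ` B"

record 'a arrow_presentation =
  arrows :: "'a set"
  next_arrow :: "'a \<Rightarrow> 'a"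
  curve_arc :: "'a arrow_end \<Rightarrow> 'a arrow_end"
  bare_curves :: nat

abbreviation ends :: "'a arrow_presentation \<Rightarrow> 'a arrow_end set" where
  "ends H \<equiv> ends_of (arrows H)"

text \<open>Both maps are the identity off the carrier, so that equality of records is equality of
  arrow presentations.\<close>

definition ribbon_hypermap :: "'a arrow_presentation \<Rightarrow> bool" where
  "ribbon_hypermap H \<longleftrightarrow>
     finite (arrows H) \<and>
     next_arrow H permutes arrows H \<and>
     curve_arc H permutes ends H \<and>
     (\<forall>x \<in> ends H. curve_arc H x \<noteq> x \<and> curve_arc H (curve_arc H x) = x)"

text \<open>The classes of \<open>X\<close> under the equivalence relation generated by \<open>R\<close>.\<close>

definition pieces :: "'b set \<Rightarrow> ('b \<times> 'b) set \<Rightarrow> 'b set set" where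
  "pieces X R = X // (R \<union> R\<inverse>)\<^sup>*"

text \<open>
  The boundary of the surface is composed of the arcs of the hypervertex curves
  (\<open>arc_rel\<close>) and of the arcs on the boundary of a hyperedge between
  the head of one arrow and the tail of the next (\<open>gap_rel\<close>).
\<close>

definition arrow_rel :: "'a arrow_presentation \<Rightarrow> ('a arrow_end \<times> 'a arrow_end) set" where
  "arrow_rel H = {(Tail a, Head a) | a. a \<in> arrows H}"

definition arc_rel :: "'a arrow_presentation \<Rightarrow> ('a arrow_end \<times> 'a arrow_end) set" where
  "arc_rel H = {(x, curve_arc H x) | x. x \<in> ends H}"

definition gap_rel :: "'a arrow_presentation \<Rightarrow> ('a arrow_end \<times> 'a arrow_end) set" where
  "gap_rel H = {(Head a, Tail (next_arrow H a)) | a. a \<in> arrows H}"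

definition hyperedges :: "'a arrow_presentation \<Rightarrow> 'a set set" where
  "hyperedges H = pieces (arrows H) {(a, next_arrow H a) | a. a \<in> arrows H}"

text \<open>The hypervertices that meet at least one hyperedge.\<close>

definition curves :: "'a arrow_presentation \<Rightarrow> 'a arrow_end set set" where
  "curves H = pieces (ends H) (arrow_rel H \<union> arc_rel H)"

text \<open>A bare hypervertex is a disc: a connected component with one boundary component.\<close>

definition num_hypervertices :: "'a arrow_presentation \<Rightarrow> nat" where
  "num_hypervertices H = card (curves H) + bare_curves H"

definition num_hyperedges :: "'a arrow_presentation \<Rightarrow> nat" where
  "num_hyperedges H = card (hyperedges H)"

definition num_hyperfaces :: "'a arrow_presentation \<Rightarrow> nat" where
  "num_hyperfaces H = card (pieces (ends H) (arc_rel H \<union> gap_rel H)) + bare_curves H"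

definition num_components :: "'a arrow_presentation \<Rightarrow> nat" where
  "num_components H =
     card (pieces (ends H) (arrow_rel H \<union> arc_rel H \<union> gap_rel H)) + bare_curves H"

definition total_degree :: "'a arrow_presentation \<Rightarrow> nat" where
  "total_degree H = (\<Sum>e \<in> hyperedges H. card e)"

definition euler_genus :: "'a arrow_presentation \<Rightarrow> int" where
  "euler_genus H = 2 * int (num_components H) + int (total_degree H)
     - int (num_hypervertices H) - int (num_hyperedges H) - int (num_hyperfaces H)"

definition connected_hypermap :: "'a arrow_presentation \<Rightarrow> bool" where
  "connected_hypermap H \<longleftrightarrow> num_components H = 1"

definition plane_hypermap :: "'a arrow_presentation \<Rightarrow> bool" where
  "plane_hypermap H \<longleftrightarrow> connected_hypermap H \<and> euler_genus H = 0"

text \<open>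
  The new arrow labelled \<open>a\<close> runs from the head of the old arrow \<open>a\<close> to the
  tail of the arrow after \<open>a\<close>; \<open>dual_pos\<close> sends an end of a new
  arrow to the old end at the same point. The arcs of the curves stay where they are. The old
  arrow after \<open>a\<close> becomes the gap from the head of the new arrow
  \<open>a\<close> to the tail of the new arrow \<open>next_arrow H a\<close>, so the
  cyclic order of the arrows around each hyperedge does not change.
\<close>

primrec dual_pos :: "'a arrow_presentation \<Rightarrow> 'a set \<Rightarrow> 'a arrow_end \<Rightarrow> 'a arrow_end" where
  "dual_pos H B (Tail a) = (if a \<in> B then Head a else Tail a)"
| "dual_pos H B (Head a) = (if a \<in> B then Tail (next_arrow H a) else Head a)"

definition partial_dual :: "'a arrow_presentation \<Rightarrow> 'a set set \<Rightarrow> 'a arrow_presentation" where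
  "partial_dual H A =
     H\<lparr>curve_arc := inv (dual_pos H (\<Union>A)) \<circ> curve_arc H \<circ> dual_pos H (\<Union>A)\<rparr>"

text \<open>The Euler genus of a ribbon hypermap is never negative, so \<open>nat\<close> does not
  truncate.\<close>

definition partial_dual_polynomial :: "'a arrow_presentation \<Rightarrow> int poly" where
  "partial_dual_polynomial H =
     (\<Sum>A \<in> Pow (hyperedges H). monom 1 (nat (euler_genus (partial_dual H A))))"

text \<open>
  Deleting the arrows outside \<open>B\<close> merges arcs: from an end of an arrow in
  \<open>B\<close> one follows the curve, passing over the deleted arrows, up to the first end
  of an arrow in \<open>B\<close>.
\<close>

definition sub_arc :: "'a arrow_presentation \<Rightarrow> 'a set \<Rightarrow> 'a arrow_end \<Rightarrow> 'a arrow_end" where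
  "sub_arc H B x =
     (let y = (\<lambda>n. ((curve_arc H \<circ> other_end) ^^ n) (curve_arc H x))
      in if x \<in> ends_of B then y (LEAST n. y n \<in> ends_of B) else x)"

definition delete_outside :: "'a arrow_presentation \<Rightarrow> 'a set set \<Rightarrow> 'a arrow_presentation" where
  "delete_outside H A =
     \<lparr>arrows = \<Union>A,
      next_arrow = (\<lambda>a. if a \<in> \<Union>A then next_arrow H a else a),
      curve_arc = sub_arc H (\<Union>A),
      bare_curves = bare_curves H + card {c \<in> curves H. c \<inter> ends_of (\<Union>A) = {}}\<rparr>"

text \<open>
  The summands of a one-vertex-joint do not contain all hypervertices of the joint, so hypervertices
  that meet no remaining hyperedge may also be discarded.
\<close>

definition sub_hypermap :: "'a arrow_presentation \<Rightarrow> 'a arrow_presentation \<Rightarrow> bool" where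
  "sub_hypermap K H \<longleftrightarrow>
     (\<exists>A m. A \<subseteq> hyperedges H \<and> m \<le> bare_curves (delete_outside H A) \<and>
        K = (delete_outside H A)\<lparr>bare_curves := m\<rparr>)"

text \<open>
  The arc with ends \<open>x\<close>, \<open>x'\<close> of \<open>H1\<close> is identified with the arc
  with ends \<open>y\<close>, \<open>y'\<close> of \<open>H2\<close>, matching \<open>x\<close> with
  \<open>y\<close>. On the boundary of the resulting hypervertex \<open>x\<close> is
  next to \<open>y\<close>, and \<open>x'\<close> next to \<open>y'\<close>. Exchanging \<open>y\<close> and
  \<open>y'\<close> gives the other way of identifying the two arcs.
\<close>

definition joint ::
  "'a arrow_presentation \<Rightarrow> 'a arrow_presentation \<Rightarrow> 'a arrow_end \<Rightarrow> 'a arrow_end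
     \<Rightarrow> 'a arrow_presentation" where
  "joint H1 H2 x y =
     (let x' = curve_arc H1 x; y' = curve_arc H2 y in
      \<lparr>arrows = arrows H1 \<union> arrows H2,
       next_arrow = (\<lambda>a. if a \<in> arrows H1 then next_arrow H1 a else next_arrow H2 a),
       curve_arc = (\<lambda>z. if z \<in> ends H1 then curve_arc H1 z else curve_arc H2 z)
         (x := y, y := x, x' := y', y' := x'),
       bare_curves = bare_curves H1 + bare_curves H2\<rparr>)"

definition one_vertex_joint ::
  "'a arrow_presentation \<Rightarrow> 'a arrow_presentation \<Rightarrow> 'a arrow_presentation \<Rightarrow> bool" where
  "one_vertex_joint H1 H2 H \<longleftrightarrow>
     arrows H1 \<inter> arrows H2 = {} \<and>
     (\<exists>x \<in> ends H1. \<exists>y \<in> ends H2. H = joint H1 H2 x y)"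

inductive iterated_joint :: "'a arrow_presentation list \<Rightarrow> 'a arrow_presentation \<Rightarrow> bool" where
  single: "iterated_joint [H] H"
| snoc: "iterated_joint Hs J \<Longrightarrow> one_vertex_joint J K H \<Longrightarrow> iterated_joint (Hs @ [K]) H"

text \<open>A summand counts as non-empty if it has a hyperedge. A bare hypervertex is the unit of the
  one-vertex-joint, so nothing would be prime if it were allowed as a summand.\<close>

definition prime_hypermap :: "'a arrow_presentation \<Rightarrow> bool" where
  "prime_hypermap H \<longleftrightarrow>
     \<not> (\<exists>Hs. length Hs \<ge> 2 \<and>
          (\<forall>K \<in> set Hs. sub_hypermap K H \<and> hyperedges K \<noteq> {}) \<and>
          iterated_joint Hs H)"

end

theory Submission
  imports Defs
begin

text \<open>
  Arcs, arrows and gaps are three perfect matchings on the set of arrow ends, and hypervertices,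
  hyperfaces and hyperedges are the cycles of their pairwise unions. Partial duality exchanges
  arrows and gaps on some hyperedges. The Euler genus of any three matchings is nonnegative, so the
  polynomial is constant only if all partial duals have genus 0. Suppose that \<open>H\<close> and its dual
  at one hyperedge \<open>e\<close> have genus 0. The genus inequality for arcs, arrows and arrows exchanged
  at \<open>e\<close>, and the same with gaps, bound below the number of hypervertices and hyperfaces that
  avoid \<open>e\<close>. Replacing the inside of \<open>e\<close> by the matching of its ends that returns along the
  hypervertex curves, the genus inequality bounds this number above. Comparing the bounds,
  every part of \<open>H\<close> outside \<open>e\<close> is attached to \<open>e\<close> along exactly two arcs, so \<open>H\<close> is
  a one-vertex-joint unless \<open>e\<close> is its only hyperedge.
\<close>

subsection \<open>Classes of the equivalence generated by a relation\<close>

text \<open>Cutting a surface along a closed curve is replaced by counting, and orientability never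
  enters because a matching has no direction. Genus 0 of \<open>H\<close> and of its dual at
  \<open>e\<close> bounds from below the sum of the left-hand sides of the two exchange
  inequalities, while their right-hand sides grow only with the pieces avoiding \<open>e\<close>;
  hence such pieces are numerous. Putting one and the same matching \<open>m\<close> in place of
  both the arrows and the gaps of \<open>e\<close> dissolves \<open>e\<close> into pairs of ends, so
  the components of the new graph are the parts of \<open>H\<close> hanging on \<open>e\<close>.
  Returning along hypervertex curves breaks the symmetry: hypervertex cycles meeting
  \<open>e\<close> then split completely, one for each pair of \<open>m\<close>, whereas for
  hyperface cycles only one per component is guaranteed. These uneven estimates suffice: they force
  at least half as many components as \<open>e\<close> has ends. Each component contains an end
  together with its partner, hence exactly two ends, and only two arcs can lead out of the rest of
  it.\<close>

definition linked :: "('b \<times> 'b) set \<Rightarrow> ('b \<times> 'b) set" where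
  "linked R = (R \<union> R\<inverse>)\<^sup>*"

definition class_of :: "('b \<times> 'b) set \<Rightarrow> 'b \<Rightarrow> 'b set" where
  "class_of R x = {y. (x, y) \<in> linked R}"

lemma linked_refl [simp]: "(x, x) \<in> linked R"
  by (simp add: linked_def)

lemma linked_sym: "(x, y) \<in> linked R \<Longrightarrow> (y, x) \<in> linked R"
proof -
  have "sym (linked R)"
    unfolding linked_def by (intro sym_rtrancl sym_Un_converse)
  then show "(x, y) \<in> linked R \<Longrightarrow> (y, x) \<in> linked R" by (auto dest: symD)
qed

lemma linked_trans: "(x, y) \<in> linked R \<Longrightarrow> (y, z) \<in> linked R \<Longrightarrow> (x, z) \<in> linked R"
  by (auto simp: linked_def)

lemma linked_edge: "(x, y) \<in> R \<Longrightarrow> (x, y) \<in> linked R"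
  by (auto simp: linked_def)

lemma subset_linked: "R \<subseteq> linked R"
  by (auto simp: linked_def)

lemma linked_least:
  assumes "R \<subseteq> linked S" shows "linked R \<subseteq> linked S"
proof -
  have "R \<union> R\<inverse> \<subseteq> linked S" using assms by (auto intro: linked_sym)
  then have "(R \<union> R\<inverse>)\<^sup>* \<subseteq> (linked S)\<^sup>*" by (rule rtrancl_mono)
  then show ?thesis by (simp add: linked_def)
qed

lemma linked_mono: "R \<subseteq> S \<Longrightarrow> linked R \<subseteq> linked S"
  by (rule linked_least) (auto intro: linked_edge)

lemma linked_eqI: "R \<subseteq> linked S \<Longrightarrow> S \<subseteq> linked R \<Longrightarrow> linked R = linked S"
  by (simp add: linked_least subset_antisym)

text \<open>Stands in for induction along a path: connectivity arguments below only name a set that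
  no edge of \<open>R\<close> enters or leaves.\<close>

lemma linked_closed:
  assumes "(x, y) \<in> linked R" "x \<in> S" "\<And>u w. (u, w) \<in> R \<Longrightarrow> u \<in> S \<longleftrightarrow> w \<in> S"
  shows "y \<in> S"
  using assms(1) unfolding linked_def
  by (induction rule: rtrancl_induct) (use assms(2,3) in auto)

lemma class_of_eq_iff: "class_of R x = class_of R y \<longleftrightarrow> (x, y) \<in> linked R"
proof
  assume "class_of R x = class_of R y"
  then have "(x, y) \<in> linked R \<longleftrightarrow> (y, y) \<in> linked R" unfolding class_of_def by blast
  then show "(x, y) \<in> linked R" by simp
next
  assume "(x, y) \<in> linked R"
  then have "(x, z) \<in> linked R \<longleftrightarrow> (y, z) \<in> linked R" for z
    by (meson linked_trans linked_sym)
  then show "class_of R x = class_of R y" by (simp add: class_of_def)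
qed

lemma linked_insert:
  "(x, y) \<in> linked (insert (a, b) R) \<longleftrightarrow>
     (x, y) \<in> linked R \<or> (x, a) \<in> linked R \<and> (b, y) \<in> linked R
       \<or> (x, b) \<in> linked R \<and> (a, y) \<in> linked R"
  (is "?l \<longleftrightarrow> ?r")
proof
  let ?S = "{y. (x, y) \<in> linked R \<or> (x, a) \<in> linked R \<and> (b, y) \<in> linked R
       \<or> (x, b) \<in> linked R \<and> (a, y) \<in> linked R}"
  assume ?l
  then have "y \<in> ?S"
  proof (rule linked_closed)
    fix u w assume "(u, w) \<in> insert (a, b) R"
    then consider "u = a" "w = b" | "(u, w) \<in> linked R" by (auto intro: linked_edge)
    then show "u \<in> ?S \<longleftrightarrow> w \<in> ?S"
    proof cases
      case 1
      then show ?thesis using linked_refl[of a R] linked_refl[of b R] by blast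
    next
      case 2
      then have "(z, u) \<in> linked R \<longleftrightarrow> (z, w) \<in> linked R" for z
        by (meson linked_trans linked_sym)
      then show ?thesis by simp
    qed
  qed simp
  then show ?r by simp
next
  assume ?r
  let ?L = "linked (insert (a, b) R)"
  have sub: "linked R \<subseteq> ?L" by (rule linked_mono) auto
  have ab: "(a, b) \<in> ?L" by (rule linked_edge) simp
  have ba: "(b, a) \<in> ?L" using ab by (rule linked_sym)
  from \<open>?r\<close> show ?l
  proof (elim disjE conjE)
    assume "(x, a) \<in> linked R" "(b, y) \<in> linked R"
    then show ?l using sub ab linked_trans by (metis subsetD)
  next
    assume "(x, b) \<in> linked R" "(a, y) \<in> linked R"
    then show ?l using sub ba linked_trans by (metis subsetD)
  qed (use sub in auto)
qed

lemma self_in_class_of [simp]: "x \<in> class_of R x"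
  by (simp add: class_of_def)

lemma class_of_subset:
  assumes "R \<subseteq> X \<times> X" "x \<in> X" shows "class_of R x \<subseteq> X"
  using linked_closed[of x _ R X] assms by (auto simp: class_of_def)

lemma pieces_class_of: "pieces X R = class_of R ` X"
  by (auto simp: pieces_def quotient_def class_of_def linked_def)

lemma pieces_cong: "linked R = linked S \<Longrightarrow> pieces X R = pieces X S"
  by (simp add: pieces_def linked_def)

lemma finite_pieces [simp]: "finite X \<Longrightarrow> finite (pieces X R)"
  by (simp add: pieces_class_of)

lemma piece_eq_class_of: "P \<in> pieces X R \<Longrightarrow> x \<in> P \<Longrightarrow> P = class_of R x"
  unfolding pieces_class_of using class_of_eq_iff[of R] by (auto simp: class_of_def)

lemma pieces_disjoint: "P \<in> pieces X R \<Longrightarrow> Q \<in> pieces X R \<Longrightarrow> P \<noteq> Q \<Longrightarrow> P \<inter> Q = {}"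
  by (metis disjoint_iff piece_eq_class_of)

lemma piece_subset: "P \<in> pieces X R \<Longrightarrow> R \<subseteq> X \<times> X \<Longrightarrow> P \<subseteq> X"
  unfolding pieces_class_of by (metis class_of_subset imageE)

lemma piece_nonempty: "P \<in> pieces X R \<Longrightarrow> P \<noteq> {}"
  unfolding pieces_class_of by (metis empty_iff image_iff self_in_class_of)

lemma card_pieces_insert:
  assumes "finite X" "a \<in> X" "b \<in> X"
  shows "card (pieces X R) =
    card (pieces X (insert (a, b) R)) + (if (a, b) \<in> linked R then 0 else 1)"
proof (cases "(a, b) \<in> linked R")
  case True
  have "linked (insert (a, b) R) = linked R"
    by (rule linked_eqI) (use True in \<open>auto intro: linked_edge\<close>)
  from pieces_cong[OF this] show ?thesis using True by simp
next
  case False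
  let ?A = "class_of R a" and ?B = "class_of R b"
  have AB: "?A \<noteq> ?B" "?A \<in> pieces X R" "?B \<in> pieces X R"
    using False assms by (auto simp: class_of_eq_iff pieces_class_of)
  have mem: "x \<in> class_of R' y \<longleftrightarrow> class_of R' y = class_of R' x" for x y and R' :: "('a \<times> 'a) set"
    unfolding class_of_eq_iff by (simp add: class_of_def)
  have new: "class_of (insert (a, b) R) x = (if x \<in> ?A \<union> ?B then ?A \<union> ?B else class_of R x)" for x
  proof (intro set_eqI)
    fix y
    \<comment> \<open>Stated for an arbitrary \<open>f\<close> in place of
      \<open>class_of R\<close>, so that only equality reasoning about four values remains.\<close>
    have eq: "(f x = f y \<or> f x = f a \<and> f b = f y \<or> f x = f b \<and> f a = f y) \<longleftrightarrow>
        (if f a = f x \<or> f b = f x then f a = f y \<or> f b = f y else f x = f y)" for f :: "'a \<Rightarrow> 'a set"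
      by (smt (verit))
    have "y \<in> class_of (insert (a, b) R) x \<longleftrightarrow> (x, y) \<in> linked (insert (a, b) R)"
      by (simp add: class_of_def)
    also have "\<dots> \<longleftrightarrow> (if x \<in> ?A \<union> ?B then y \<in> ?A \<union> ?B else y \<in> class_of R x)"
      unfolding linked_insert class_of_eq_iff[of R, symmetric] Un_iff mem by (rule eq)
    finally show "y \<in> class_of (insert (a, b) R) x \<longleftrightarrow>
        y \<in> (if x \<in> ?A \<union> ?B then ?A \<union> ?B else class_of R x)"
      by (simp split: if_splits)
  qed
  have old: "x \<in> ?A \<union> ?B \<longleftrightarrow> class_of R x \<in> {?A, ?B}" for x
    unfolding Un_iff mem by auto
  have "pieces X (insert (a, b) R) = insert (?A \<union> ?B) (pieces X R - {?A, ?B})"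
    unfolding pieces_class_of
  proof (intro set_eqI iffI)
    fix P assume "P \<in> class_of (insert (a, b) R) ` X"
    then obtain x where "x \<in> X" "P = class_of (insert (a, b) R) x" by blast
    with new[of x] old[of x] show "P \<in> insert (?A \<union> ?B) (class_of R ` X - {?A, ?B})"
      by (cases "x \<in> ?A \<union> ?B") simp_all
  next
    fix P assume "P \<in> insert (?A \<union> ?B) (class_of R ` X - {?A, ?B})"
    then consider "P = ?A \<union> ?B" | x where "x \<in> X" "P = class_of R x" "x \<notin> ?A \<union> ?B"
      using old by blast
    then show "P \<in> class_of (insert (a, b) R) ` X"
    proof cases
      case 1
      then have "P = class_of (insert (a, b) R) a" using new[of a] by simp
      then show ?thesis using assms(2) by simp
    next
      case 2
      then have "P = class_of (insert (a, b) R) x" using new[of x] by simp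
      then show ?thesis using 2 by simp
    qed
  qed
  moreover have "?A \<union> ?B \<notin> pieces X R - {?A, ?B}"
    by (metis AB(2) DiffE UnI1 insertI1 piece_eq_class_of self_in_class_of)
  moreover have "card (pieces X R) = card (pieces X R - {?A, ?B}) + 2"
    using AB assms(1) card_Diff_subset[of "{?A, ?B}" "pieces X R"]
      card_mono[of "pieces X R" "{?A, ?B}"] by auto
  ultimately show ?thesis using False assms(1) by simp
qed

text \<open>Without edges all classes are singletons, and each edge merges at most two
  classes.\<close>

lemma card_le_card_pieces:
  assumes "finite X" "finite R" "R \<subseteq> X \<times> X"
  shows "card X \<le> card (pieces X R) + card R"
  using assms(2,3)
proof (induction R rule: finite_induct)
  case empty
  have "class_of {} x = {x}" for x :: 'a by (auto simp: class_of_def linked_def)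
  then show ?case by (simp add: pieces_class_of card_image)
next
  case (insert r R)
  obtain a b where "r = (a, b)" by (cases r)
  with insert card_pieces_insert[OF assms(1), of a b R] show ?case by (auto split: if_splits)
qed

text \<open>Nothing is required outside \<open>X\<close>, so one function can be a matching on
  \<open>X\<close>, on a hyperedge \<open>Y\<close> and on \<open>X - Y\<close> at once.\<close>

definition matching :: "'b set \<Rightarrow> ('b \<Rightarrow> 'b) \<Rightarrow> bool" where
  "matching X f \<longleftrightarrow> (\<forall>x\<in>X. f x \<in> X \<and> f x \<noteq> x \<and> f (f x) = x)"

definition graph_on :: "'b set \<Rightarrow> ('b \<Rightarrow> 'b) \<Rightarrow> ('b \<times> 'b) set" where
  "graph_on X f = {(x, f x) | x. x \<in> X}"

lemma graph_on_iff: "(x, y) \<in> graph_on X f \<longleftrightarrow> x \<in> X \<and> y = f x"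
  by (auto simp: graph_on_def)

lemma graph_on_subset: "matching X f \<Longrightarrow> graph_on X f \<subseteq> X \<times> X"
  by (auto simp: graph_on_def matching_def)

lemma matching_closed_subset:
  "matching X f \<Longrightarrow> Z \<subseteq> X \<Longrightarrow> (\<And>x. x \<in> Z \<Longrightarrow> f x \<in> Z) \<Longrightarrow> matching Z f"
  by (auto simp: matching_def)

lemma matching_Diff: "matching X f \<Longrightarrow> matching Y f \<Longrightarrow> matching (X - Y) f"
  unfolding matching_def by (metis DiffD1 DiffD2 DiffI)

text \<open>Representatives of the edges, needed for counting because \<open>graph_on\<close>
  contains every edge in both directions.\<close>

lemma matching_transversal:
  assumes "finite X" "matching X f"
  shows "\<exists>S\<subseteq>X. X \<subseteq> S \<union> f ` S \<and> card X = 2 * card S"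
  using assms
proof (induction "card X" arbitrary: X rule: less_induct)
  case less
  show ?case
  proof (cases "X = {}")
    case False
    then obtain x where x: "x \<in> X" by auto
    let ?Z = "X - {x, f x}"
    have fx: "f x \<in> X" "f x \<noteq> x" "f (f x) = x" using less.prems(2) x by (auto simp: matching_def)
    have "matching {x, f x} f" using fx by (auto simp: matching_def)
    then have m: "matching ?Z f" using less.prems(2) matching_Diff by blast
    have c: "card X = card ?Z + 2"
      using x fx less.prems(1) card_Diff_subset[of "{x, f x}" X] card_mono[of X "{x, f x}"] by auto
    then obtain S where S: "S \<subseteq> ?Z" "?Z \<subseteq> S \<union> f ` S" "card ?Z = 2 * card S"
      using less.hyps[of ?Z] less.prems(1) m by auto
    have "finite S" using S(1) less.prems(1) by (meson finite_Diff finite_subset)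
    then have "card (insert x S) = Suc (card S)" using S(1) by (subst card_insert_disjoint) auto
    then show ?thesis using S c x by (intro exI[of _ "insert x S"]) auto
  qed auto
qed

lemma matching_even_card: "finite X \<Longrightarrow> matching X f \<Longrightarrow> even (card X)"
  using matching_transversal[of X f] by auto

text \<open>The pairing hypothesis holds when \<open>p, p', q, q'\<close> are the ends of two edges deleted
  from a graph containing a perfect matching.\<close>

lemma card_pieces_exchange:
  assumes X: "finite X" "p \<in> X" "p' \<in> X" "q \<in> X" "q' \<in> X"
    and par: "(p, p') \<in> linked S \<and> (q, q') \<in> linked S \<or> (p, q) \<in> linked S \<and> (p', q') \<in> linked S
      \<or> (p, q') \<in> linked S \<and> (p', q) \<in> linked S"
  defines "m \<equiv> card (pieces X (insert (p, p') (insert (q, q') S)))"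
    and "m' \<equiv> card (pieces X (insert (p, q) (insert (p', q') S)))"
  shows "m \<le> m' + 1"
    and "(p, q) \<in> linked S \<Longrightarrow> m' = (if (p, p') \<in> linked S then m else m + 1)"
    and "\<not> (p, q) \<in> linked S \<Longrightarrow> \<not> (p, q') \<in> linked S \<Longrightarrow> m = m' + 1"
proof -
  have 1: "card (pieces X S) = card (pieces X (insert (q, q') S)) + (if (q, q') \<in> linked S then 0 else 1)"
    "card (pieces X S) = card (pieces X (insert (p', q') S)) + (if (p', q') \<in> linked S then 0 else 1)"
    "card (pieces X (insert (q, q') S)) = m + (if (p, p') \<in> linked (insert (q, q') S) then 0 else 1)"
    "card (pieces X (insert (p', q') S)) = m' + (if (p, q) \<in> linked (insert (p', q') S) then 0 else 1)"
    unfolding m_def m'_def by (intro card_pieces_insert X)+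
  note sp = par 1 linked_insert[of p p' q q' S] linked_insert[of p q p' q' S]
  \<comment> \<open>Membership in \<open>linked S\<close> becomes equality of classes, so that
    transitivity and symmetry come for free in the case analysis.\<close>
  note sp = sp[folded class_of_eq_iff[of S]]
  show "m \<le> m' + 1" using sp by (elim disjE conjE; simp split: if_splits)
  show "(p, q) \<in> linked S \<Longrightarrow> m' = (if (p, p') \<in> linked S then m else m + 1)"
    unfolding class_of_eq_iff[symmetric] using sp by (elim disjE conjE; simp split: if_splits)
  show "\<not> (p, q) \<in> linked S \<Longrightarrow> \<not> (p, q') \<in> linked S \<Longrightarrow> m = m' + 1"
    unfolding class_of_eq_iff[symmetric] using sp by (elim disjE conjE; simp split: if_splits)
qed

subsection \<open>The genus inequality for three matchings\<close>

lemma in_class_of_iff: "y \<in> class_of R x \<longleftrightarrow> class_of R x = class_of R y"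
  unfolding class_of_eq_iff by (simp add: class_of_def)

lemma class_of_linked: "(u, w) \<in> linked R \<Longrightarrow> u \<in> class_of R x \<longleftrightarrow> w \<in> class_of R x"
  by (metis in_class_of_iff class_of_eq_iff)

lemma class_of_closed: "(u, w) \<in> R \<Longrightarrow> u \<in> class_of R x \<longleftrightarrow> w \<in> class_of R x"
  by (intro class_of_linked linked_edge)

lemma piece_closed: "P \<in> pieces X R \<Longrightarrow> (u, w) \<in> R \<Longrightarrow> u \<in> P \<longleftrightarrow> w \<in> P"
  unfolding pieces_class_of using class_of_closed[of u w R] by auto

lemma Union_pieces:
  assumes "R \<subseteq> X \<times> X" shows "\<Union>(pieces X R) = X"
proof
  show "\<Union>(pieces X R) \<subseteq> X" using piece_subset[OF _ assms] by auto
  show "X \<subseteq> \<Union>(pieces X R)" using self_in_class_of unfolding pieces_class_of by fast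
qed

lemma sum_card_pieces_Int:
  assumes "\<P> \<subseteq> pieces X R" "finite X" "finite Z"
  shows "(\<Sum>P\<in>\<P>. card (P \<inter> Z)) = card (\<Union>\<P> \<inter> Z)"
proof -
  have "card (\<Union>P\<in>\<P>. P \<inter> Z) = (\<Sum>P\<in>\<P>. card (P \<inter> Z))"
  proof (rule card_UN_disjoint)
    show "finite \<P>" using assms by (meson finite_pieces finite_subset)
    show "\<forall>P\<in>\<P>. finite (P \<inter> Z)" using assms by simp
    show "\<forall>P\<in>\<P>. \<forall>Q\<in>\<P>. P \<noteq> Q \<longrightarrow> (P \<inter> Z) \<inter> (Q \<inter> Z) = {}"
    proof (intro ballI impI)
      fix P Q assume "P \<in> \<P>" "Q \<in> \<P>" "P \<noteq> Q"
      then have "P \<inter> Q = {}" using assms(1) pieces_disjoint by (metis subsetD)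
      then show "(P \<inter> Z) \<inter> (Q \<inter> Z) = {}" by auto
    qed
  qed
  moreover have "(\<Union>P\<in>\<P>. P \<inter> Z) = \<Union>\<P> \<inter> Z" by auto
  ultimately show ?thesis by simp
qed

lemma two_card_pieces_le:
  assumes "\<P> \<subseteq> pieces X R" "finite X" "finite Z" "\<And>P. P \<in> \<P> \<Longrightarrow> 2 \<le> card (P \<inter> Z)"
  shows "2 * card \<P> \<le> card Z"
proof -
  have "2 * card \<P> = (\<Sum>P\<in>\<P>. 2)" by simp
  also have "\<dots> \<le> (\<Sum>P\<in>\<P>. card (P \<inter> Z))" by (rule sum_mono) (rule assms(4))
  also have "\<dots> \<le> card Z"
    unfolding sum_card_pieces_Int[OF assms(1-3)] using assms(3) by (intro card_mono) auto
  finally show ?thesis .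
qed

lemma card_le_two_card_pieces:
  assumes "\<P> \<subseteq> pieces X R" "finite X" "finite Z" "Z \<subseteq> \<Union>\<P>" "\<And>P. P \<in> \<P> \<Longrightarrow> card (P \<inter> Z) \<le> 2"
  shows "card Z \<le> 2 * card \<P>"
proof -
  have "card Z = (\<Sum>P\<in>\<P>. card (P \<inter> Z))"
    unfolding sum_card_pieces_Int[OF assms(1-3)] using assms(4) by (simp add: Int_absorb1)
  also have "\<dots> \<le> (\<Sum>P\<in>\<P>. 2)" by (rule sum_mono) (rule assms(5))
  finally show ?thesis by simp
qed

text \<open>The equality case of \<open>two_card_pieces_le\<close>: a class with a third element of
  \<open>Z\<close> would push the total above \<open>card Z\<close>.\<close>

lemma card_piece_eq_two:
  assumes "\<P> \<subseteq> pieces X R" "finite X" "finite Z" "\<And>P. P \<in> \<P> \<Longrightarrow> 2 \<le> card (P \<inter> Z)"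
    and "card Z \<le> 2 * card \<P>" "P \<in> \<P>"
  shows "card (P \<inter> Z) = 2"
proof (rule ccontr)
  assume "card (P \<inter> Z) \<noteq> 2"
  with assms(4,6) have "2 < card (P \<inter> Z)" by fastforce
  moreover have "finite \<P>" using assms(1,2) by (meson finite_pieces finite_subset)
  ultimately have "(\<Sum>P\<in>\<P>. 2) < (\<Sum>P\<in>\<P>. card (P \<inter> Z))"
    using assms(4,6) by (intro sum_strict_mono_ex1) auto
  also have "\<dots> \<le> card Z"
    unfolding sum_card_pieces_Int[OF assms(1-3)] using assms(3) by (intro card_mono) auto
  finally show False using assms(5) by simp
qed

lemma two_le_card:
  assumes "finite A" "a \<in> A" "b \<in> A" "a \<noteq> b" shows "2 \<le> card A"
  using card_mono[of A "{a, b}"] assms by auto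

lemma two_card_matching_pieces_le:
  assumes "finite X" "matching X f" "graph_on X f \<subseteq> R" "R \<subseteq> X \<times> X"
  shows "2 * card (pieces X R) \<le> card X"
proof (rule two_card_pieces_le[OF subset_refl])
  fix P assume P: "P \<in> pieces X R"
  then obtain x where x: "x \<in> P" using piece_nonempty by (metis all_not_in_conv)
  have sub: "P \<subseteq> X" using P assms(4) piece_subset by metis
  then have "(x, f x) \<in> R" using x assms(3) by (auto simp: graph_on_iff subset_iff)
  then have "f x \<in> P" using x P piece_closed by metis
  moreover have "f x \<noteq> x" using x sub assms(2) by (auto simp: matching_def)
  moreover have "finite (P \<inter> X)" using assms(1) by simp
  ultimately show "2 \<le> card (P \<inter> X)" using two_le_card[of "P \<inter> X" x "f x"] x sub by auto
qed (use assms in auto)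

lemma matching_piece_even:
  assumes "finite X" "matching X f" "graph_on X f \<subseteq> R" "R \<subseteq> X \<times> X" "P \<in> pieces X R"
  shows "even (card P)" "matching P f"
proof -
  have sub: "P \<subseteq> X" using assms piece_subset by metis
  have "f x \<in> P" if "x \<in> P" for x
    using that sub assms(3,5) piece_closed[of P X R x "f x"] by (auto simp: graph_on_iff subset_iff)
  then show "matching P f" using sub assms(2) by (auto simp: matching_def)
  then show "even (card P)" using sub assms(1) by (metis finite_subset matching_even_card)
qed

lemma even_card_Int4:
  assumes "distinct [a, b, c, d]"
  shows "even (card (C \<inter> {a, b, c, d})) \<longleftrightarrow> ((a \<in> C \<longleftrightarrow> b \<in> C) \<longleftrightarrow> (c \<in> C \<longleftrightarrow> d \<in> C))"
  using assms by (cases "a \<in> C"; cases "b \<in> C"; cases "c \<in> C"; cases "d \<in> C") simp_all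

text \<open>A switch of two edges. It is used with \<open>y = g x\<close>, so that afterwards
  \<open>f\<close> and \<open>g\<close> agree at \<open>x\<close>.\<close>

definition rewire :: "('b \<Rightarrow> 'b) \<Rightarrow> 'b \<Rightarrow> 'b \<Rightarrow> 'b \<Rightarrow> 'b" where
  "rewire f x y = f(x := y, y := x, f x := f y, f y := f x)"

context
  fixes X :: "'b set" and f :: "'b \<Rightarrow> 'b" and x y :: 'b
  assumes X: "finite X" "matching X f" "x \<in> X" "y \<in> X" "y \<noteq> x" "y \<noteq> f x"
begin

private definition "rest = graph_on (X - {x, y, f x, f y}) f"

lemma rewire_distinct: "distinct [x, f x, y, f y]" "f (f x) = x" "f (f y) = y" "f x \<in> X" "f y \<in> X"
proof -
  show inv: "f (f x) = x" "f (f y) = y" and "f x \<in> X" "f y \<in> X"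
    using X by (auto simp: matching_def)
  have "f x \<noteq> x" "f y \<noteq> y" using X by (auto simp: matching_def)
  moreover have "f x \<noteq> f y" "x \<noteq> f y" using X(5,6) inv by metis+
  ultimately show "distinct [x, f x, y, f y]" using X(5,6) by auto
qed

lemma rewire_simps: "rewire f x y x = y" "rewire f x y y = x" "rewire f x y (f x) = f y"
  "rewire f x y (f y) = f x" "z \<notin> {x, y, f x, f y} \<Longrightarrow> rewire f x y z = f z"
  using rewire_distinct by (auto simp: rewire_def)

lemma matching_rewire: "matching X (rewire f x y)"
  unfolding matching_def
proof
  fix z assume z: "z \<in> X"
  show "rewire f x y z \<in> X \<and> rewire f x y z \<noteq> z \<and> rewire f x y (rewire f x y z) = z"
  proof (cases "z \<in> {x, y, f x, f y}")
    case True
    then show ?thesis using rewire_simps rewire_distinct X(3,4) by auto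
  next
    case False
    moreover have "f z \<in> X" "f z \<noteq> z" "f (f z) = z" using z X(2) by (auto simp: matching_def)
    moreover have "f z \<notin> {x, y, f x, f y}" using calculation rewire_distinct by auto
    ultimately show ?thesis using rewire_simps(5) by simp
  qed
qed

private lemma linked_graph:
  "linked (graph_on X f \<union> S) = linked (insert (x, f x) (insert (y, f y) (rest \<union> S)))"
  (is "_ = linked ?N")
proof (rule linked_eqI)
  show "graph_on X f \<union> S \<subseteq> linked ?N"
  proof
    fix e assume "e \<in> graph_on X f \<union> S"
    then consider "e \<in> linked ?N" | "e = (f x, x)" | "e = (f y, y)"
      using rewire_distinct(2,3) subset_linked[of ?N] by (auto simp: graph_on_def rest_def)
    then show "e \<in> linked ?N"
      by cases (simp_all add: linked_edge linked_sym[OF linked_edge])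
  qed
  show "?N \<subseteq> linked (graph_on X f \<union> S)"
    using X by (auto simp: rest_def graph_on_def intro!: linked_edge)
qed

private lemma linked_rewire:
  "linked (graph_on X (rewire f x y) \<union> S) = linked (insert (x, y) (insert (f x, f y) (rest \<union> S)))"
  (is "linked ?M = linked ?N")
proof (rule linked_eqI)
  show "?M \<subseteq> linked ?N"
  proof
    fix e assume "e \<in> ?M"
    then consider z where "z \<in> X" "e = (z, rewire f x y z)" | "e \<in> S"
      unfolding graph_on_def by blast
    then show "e \<in> linked ?N"
    proof cases
      case 1
      consider "z = x" | "z = y" | "z = f x" | "z = f y" | "z \<notin> {x, y, f x, f y}" by blast
      then have "e \<in> ?N \<or> e = (y, x) \<or> e = (f y, f x)"
      proof cases
        case 5
        then have "e \<in> rest" using 1 rewire_simps(5)[OF 5] by (simp add: rest_def graph_on_iff)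
        then show ?thesis by blast
      qed (use 1 rewire_simps in simp_all)
      moreover have "(y, x) \<in> linked ?N" "(f y, f x) \<in> linked ?N"
        by (simp_all add: linked_sym[OF linked_edge])
      ultimately show ?thesis using subset_linked[of ?N] by blast
    next
      case 2
      then show ?thesis using subset_linked[of ?N] by auto
    qed
  qed
  have "(x, y) \<in> ?M" "(f x, f y) \<in> ?M"
    using X(3) rewire_distinct(4) by (simp_all add: graph_on_iff rewire_simps)
  moreover have "rest \<subseteq> ?M"
    by (auto simp: rest_def graph_on_def rewire_simps)
  ultimately show "?N \<subseteq> linked ?M" by (auto intro!: linked_edge)
qed

text \<open>Each class is a union of edges of \<open>h\<close> and, apart from the four ends in question,
  of \<open>f\<close>, so it contains an even number of these ends.\<close>

private lemma rewire_pairing: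
  assumes h: "matching X h" "graph_on X h \<subseteq> S" "S \<subseteq> X \<times> X"
  defines "T \<equiv> rest \<union> S"
  shows "(x, f x) \<in> linked T \<and> (y, f y) \<in> linked T \<or> (x, y) \<in> linked T \<and> (f x, f y) \<in> linked T
      \<or> (x, f y) \<in> linked T \<and> (f x, y) \<in> linked T"
proof -
  have T: "graph_on X h \<subseteq> T" "T \<subseteq> X \<times> X"
    using h X(2) by (auto simp: T_def rest_def graph_on_def matching_def)
  have "(x \<in> C \<longleftrightarrow> f x \<in> C) \<longleftrightarrow> (y \<in> C \<longleftrightarrow> f y \<in> C)" if C: "C \<in> pieces X T" for C
  proof -
    have sub: "C \<subseteq> X" using C T(2) piece_subset by metis
    have fin: "finite C" using sub X(1) finite_subset by auto
    have "f z \<in> C - {x, f x, y, f y}" if "z \<in> C - {x, f x, y, f y}" for z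
    proof -
      have "(z, f z) \<in> T" using that sub by (auto simp: T_def rest_def graph_on_def)
      then have "f z \<in> C" using that C piece_closed by (metis DiffD1)
      moreover have "f (f z) = z" using that sub X(2) by (auto simp: matching_def)
      ultimately show ?thesis using that rewire_distinct by auto
    qed
    then have "matching (C - {x, f x, y, f y}) f"
      using matching_closed_subset[OF X(2), of "C - {x, f x, y, f y}"] sub by blast
    then have "even (card (C - {x, f x, y, f y}))" using fin matching_even_card by blast
    moreover have "even (card C)" using matching_piece_even(1)[OF X(1) h(1) T C] .
    moreover have "card C = card (C \<inter> {x, f x, y, f y}) + card (C - {x, f x, y, f y})"
      using card_Int_Diff[OF fin] .
    ultimately have "even (card (C \<inter> {x, f x, y, f y}))" by simp
    then show ?thesis using even_card_Int4[OF rewire_distinct(1)] by blast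
  qed
  then have C: "(x \<in> class_of T z \<longleftrightarrow> f x \<in> class_of T z) \<longleftrightarrow> (y \<in> class_of T z \<longleftrightarrow> f y \<in> class_of T z)"
    if "z \<in> X" for z using that by (simp add: pieces_class_of)
  \<comment> \<open>Parity in the classes of \<open>x\<close>, \<open>y\<close> and
    \<open>f x\<close> rules out an end that is alone in its class or in a class with exactly two of
    the others.\<close>
  have "(C x = C (f x)) \<and> (C y = C (f y)) \<or> (C x = C y) \<and> (C (f x) = C (f y))
      \<or> (C x = C (f y)) \<and> (C (f x) = C y)" if
    "\<And>z. z \<in> {x, y, f x} \<Longrightarrow> (C z = C x \<longleftrightarrow> C z = C (f x)) \<longleftrightarrow> (C z = C y \<longleftrightarrow> C z = C (f y))" for C :: "'b \<Rightarrow> 'b set"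
    using that[of x] that[of y] that[of "f x"] by (smt (verit) insert_iff)
  from this[of "class_of T"] show ?thesis
    using C X(3,4) rewire_distinct(4) unfolding in_class_of_iff class_of_eq_iff by blast
qed

text \<open>Since \<open>g\<close> already joins \<open>x\<close> to \<open>y\<close>, the switch
  splits off \<open>{x, y}\<close> as a cycle of \<open>f'\<close> and \<open>g\<close>. Against
  \<open>h\<close> the number of cycles may drop by one, but it rises whenever the switch creates a
  new component. Together: the number of all cycles minus twice the number of components does not
  decrease.\<close>

lemma rewire_step:
  assumes g: "matching X g" "y = g x" and h: "matching X h"
  defines "f' \<equiv> rewire f x y"
  shows "card (pieces X (graph_on X f' \<union> graph_on X g)) = card (pieces X (graph_on X f \<union> graph_on X g)) + 1"
    and "card (pieces X (graph_on X f \<union> graph_on X h)) + 2 * card (pieces X (graph_on X f' \<union> (graph_on X g \<union> graph_on X h)))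
      \<le> card (pieces X (graph_on X f' \<union> graph_on X h)) + 2 * card (pieces X (graph_on X f \<union> (graph_on X g \<union> graph_on X h))) + 1"
proof -
  let ?gh = "graph_on X g \<union> graph_on X h"
  have X5: "finite X" "x \<in> X" "f x \<in> X" "y \<in> X" "f y \<in> X"
    using X rewire_distinct by auto
  have count: "pieces X (graph_on X f \<union> S) = pieces X (insert (x, f x) (insert (y, f y) (rest \<union> S)))"
    "pieces X (graph_on X f' \<union> S) = pieces X (insert (x, y) (insert (f x, f y) (rest \<union> S)))" for S
    unfolding f'_def by (intro pieces_cong linked_graph linked_rewire)+
  have sub: "graph_on X g \<subseteq> X \<times> X" "graph_on X h \<subseteq> X \<times> X" "?gh \<subseteq> X \<times> X"
    using g h graph_on_subset by (metis, metis, metis le_sup_iff)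
  note ex = card_pieces_exchange[OF X5 rewire_pairing, folded count]
  have xy: "(x, y) \<in> linked (rest \<union> S)" if "graph_on X g \<subseteq> S" for S
    using that X(3) g(2) by (intro linked_edge UnI2) (simp add: graph_on_iff subset_iff)
  \<comment> \<open>Once the edges of \<open>f\<close> at \<open>x\<close> and \<open>y\<close> are
    removed, no edge leaves \<open>{x, y}\<close>.\<close>
  have sep: "(x, f x) \<notin> linked (rest \<union> graph_on X g)"
  proof
    assume "(x, f x) \<in> linked (rest \<union> graph_on X g)"
    then have "f x \<in> {x, y}"
    proof (rule linked_closed)
      fix u w assume "(u, w) \<in> rest \<union> graph_on X g"
      then consider "u \<in> X - {x, y, f x, f y}" "w = f u" | "u \<in> X" "w = g u"
        by (auto simp: rest_def graph_on_def)
      then show "u \<in> {x, y} \<longleftrightarrow> w \<in> {x, y}"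
      proof cases
        case 1
        then have "f w = u" using X(2) by (auto simp: matching_def)
        then show ?thesis using 1 by blast
      next
        case 2
        then have "g w = u" "g y = x" using X(3) g by (auto simp: matching_def)
        then show ?thesis using 2(2) g(2) by (metis insert_iff singletonD)
      qed
    qed simp
    then show False using rewire_distinct(1) by auto
  qed
  show "card (pieces X (graph_on X f' \<union> graph_on X g)) = card (pieces X (graph_on X f \<union> graph_on X g)) + 1"
    using ex(2)[OF g(1) subset_refl sub(1)] xy[OF subset_refl] sep by simp
  \<comment> \<open>As \<open>g\<close> joins \<open>x\<close> to \<open>y\<close>, the switch
    cannot merge components; it splits one exactly if \<open>x\<close> and \<open>f x\<close> were
    connected only through the removed edges.\<close>
  have 1: "card (pieces X (graph_on X f' \<union> ?gh)) =
      (if (x, f x) \<in> linked (rest \<union> ?gh) then card (pieces X (graph_on X f \<union> ?gh))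
       else card (pieces X (graph_on X f \<union> ?gh)) + 1)"
    using ex(2)[OF g(1) _ sub(3)] xy[of ?gh] by simp
  show "card (pieces X (graph_on X f \<union> graph_on X h)) + 2 * card (pieces X (graph_on X f' \<union> ?gh))
      \<le> card (pieces X (graph_on X f' \<union> graph_on X h)) + 2 * card (pieces X (graph_on X f \<union> ?gh)) + 1"
  proof (cases "(x, f x) \<in> linked (rest \<union> ?gh)")
    case True
    then show ?thesis using 1 ex(1)[OF h subset_refl sub(2)] by simp
  next
    case False
    \<comment> \<open>Here \<open>x, y\<close> and \<open>f x, f y\<close> lie in different components after rewiring,
      so the rewiring splits a cycle of \<open>f\<close> and \<open>h\<close>.\<close>
    have par: "(x, f x) \<in> linked T \<and> (y, f y) \<in> linked T \<or> (x, y) \<in> linked T \<and> (f x, f y) \<in> linked T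
      \<or> (x, f y) \<in> linked T \<and> (f x, y) \<in> linked T" if "T = rest \<union> graph_on X h" for T
      using rewire_pairing[OF h subset_refl sub(2)] that by simp
    have mono: "linked (rest \<union> graph_on X h) \<subseteq> linked (rest \<union> ?gh)" by (rule linked_mono) auto
    have xy': "(x, y) \<in> linked (rest \<union> ?gh)" by (rule xy) simp
    have nx: "(x, f x) \<notin> linked (rest \<union> graph_on X h)" using False mono by blast
    have "(f x, y) \<notin> linked (rest \<union> graph_on X h)"
      using False mono linked_trans[OF xy'] linked_sym by (metis subsetD)
    then have "(x, y) \<in> linked (rest \<union> graph_on X h)" using nx par[OF refl] by blast
    then have "card (pieces X (graph_on X f' \<union> graph_on X h)) = card (pieces X (graph_on X f \<union> graph_on X h)) + 1"
      using ex(2)[OF h subset_refl sub(2)] nx by simp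
    then show ?thesis using 1 False by simp
  qed
qed

end

text \<open>Gluing a disc to every two-coloured cycle of this cubic graph yields a closed surface
  with \<open>card X\<close> vertices and \<open>3 * card X / 2\<close> edges; the bound, doubled to
  avoid fractions, says that its Euler characteristic is at most 2 per component. Hence the summand
  4 for a connected graph of genus 0. Switches move \<open>f\<close> towards \<open>g\<close>
  without decreasing cycles minus twice components, and for \<open>f = g\<close> only the fact that
  cycles have at least two vertices remains.\<close>

theorem euler_inequality:
  assumes "finite X" "matching X f" "matching X g" "matching X h"
  shows "2 * (card (pieces X (graph_on X f \<union> graph_on X g)) + card (pieces X (graph_on X g \<union> graph_on X h))
      + card (pieces X (graph_on X f \<union> graph_on X h)))
    \<le> card X + 4 * card (pieces X (graph_on X f \<union> (graph_on X g \<union> graph_on X h)))"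
  using assms(2)
proof (induction "card {x \<in> X. f x \<noteq> g x}" arbitrary: f rule: less_induct)
  case less
  show ?case
  proof (cases "\<exists>x\<in>X. f x \<noteq> g x")
    case False
    then have eq: "graph_on X f = graph_on X g" by (auto simp: graph_on_def)
    have "2 * card (pieces X (graph_on X g)) \<le> card X"
      using two_card_matching_pieces_le[OF assms(1,3) subset_refl] graph_on_subset[OF assms(3)] .
    moreover have "graph_on X g \<union> (graph_on X g \<union> graph_on X h) = graph_on X g \<union> graph_on X h" by auto
    ultimately show ?thesis by (simp add: eq)
  next
    case True
    then obtain x where x: "x \<in> X" "f x \<noteq> g x" by auto
    let ?f = "rewire f x (g x)"
    have gx: "g x \<in> X" "g x \<noteq> x" "g (g x) = x" "g x \<noteq> f x" using x assms(3) by (auto simp: matching_def)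
    note rw = assms(1) less.prems x(1) gx(1,2,4)
    \<comment> \<open>No agreement is spoiled: if \<open>f z = g z\<close> and \<open>z\<close> is
      \<open>f x\<close> or \<open>f (g x)\<close>, then \<open>z\<close> is \<open>g x\<close> or
      \<open>x\<close>, where the switch produces agreement.\<close>
    have "{z \<in> X. ?f z \<noteq> g z} \<subseteq> {z \<in> X. f z \<noteq> g z} - {x}"
    proof
      fix z assume z: "z \<in> {z \<in> X. ?f z \<noteq> g z}"
      then have "z \<noteq> x" "z \<noteq> g x" using rewire_simps[OF rw] gx by auto
      moreover have "f z \<noteq> g z"
      proof
        assume eq: "f z = g z"
        have "z \<in> {x, g x, f x, f (g x)}"
        proof (rule ccontr)
          assume "z \<notin> {x, g x, f x, f (g x)}"
          from rewire_simps(5)[OF rw this] show False using z eq by simp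
        qed
        then have "z = f x \<or> z = f (g x)" using calculation by auto
        then have "g z = x \<or> g z = g x" using eq rewire_distinct[OF rw] by auto
        moreover have "g (g z) = z" using z assms(3) by (auto simp: matching_def)
        ultimately show False using gx \<open>z \<noteq> x\<close> \<open>z \<noteq> g x\<close> by auto
      qed
      ultimately show "z \<in> {z \<in> X. f z \<noteq> g z} - {x}" using z by auto
    qed
    then have "card {z \<in> X. ?f z \<noteq> g z} < card {z \<in> X. f z \<noteq> g z}"
      using x assms(1) by (intro psubset_card_mono) auto
    from less.hyps[OF this matching_rewire[OF rw]]
    show ?thesis using rewire_step[OF rw assms(3) refl assms(4)] by simp
  qed
qed

subsection \<open>Pieces meeting or missing a set of vertices\<close>

definition meeting_pieces :: "'b set \<Rightarrow> ('b \<times> 'b) set \<Rightarrow> 'b set \<Rightarrow> 'b set set" where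
  "meeting_pieces X R Y = {P \<in> pieces X R. P \<inter> Y \<noteq> {}}"

definition missing_pieces :: "'b set \<Rightarrow> ('b \<times> 'b) set \<Rightarrow> 'b set \<Rightarrow> 'b set set" where
  "missing_pieces X R Y = {P \<in> pieces X R. P \<inter> Y = {}}"

lemma card_pieces_split:
  assumes "finite X"
  shows "card (pieces X R) = card (missing_pieces X R Y) + card (meeting_pieces X R Y)"
proof -
  have "pieces X R = missing_pieces X R Y \<union> meeting_pieces X R Y"
    "missing_pieces X R Y \<inter> meeting_pieces X R Y = {}"
    by (auto simp: missing_pieces_def meeting_pieces_def)
  moreover have "finite (missing_pieces X R Y)" "finite (meeting_pieces X R Y)"
    using assms by (simp_all add: missing_pieces_def meeting_pieces_def)
  ultimately show ?thesis by (metis card_Un_disjoint)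
qed

text \<open>A path in \<open>R'\<close> can leave the class only by an edge touching it. Such an
  edge is not inside \<open>Y \<times> Y\<close>, so it belongs to \<open>R\<close> as well.\<close>

lemma class_of_subset_if_missing:
  assumes "class_of R x \<inter> Y = {}" "R - Y \<times> Y = R' - Y \<times> Y"
  shows "class_of R' x \<subseteq> class_of R x"
proof
  fix z assume "z \<in> class_of R' x"
  then have "(x, z) \<in> linked R'" by (simp add: class_of_def)
  then show "z \<in> class_of R x"
  proof (rule linked_closed)
    fix u w assume uw: "(u, w) \<in> R'"
    show "u \<in> class_of R x \<longleftrightarrow> w \<in> class_of R x"
    proof (cases "u \<in> class_of R x \<or> w \<in> class_of R x")
      case True
      then have "(u, w) \<in> R" using uw assms by blast
      then show ?thesis by (rule class_of_closed)
    qed auto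
  qed simp
qed

text \<open>Makes the number of pieces away from a hyperedge independent of what is drawn inside it,
  so graphs differing only inside \<open>Y\<close> can be compared through this number.\<close>

lemma missing_pieces_cong:
  assumes "R - Y \<times> Y = R' - Y \<times> Y"
  shows "missing_pieces X R Y = missing_pieces X R' Y"
proof -
  have *: "class_of R x = class_of R' x"
    if "class_of R x \<inter> Y = {}" "R - Y \<times> Y = R' - Y \<times> Y" for x R R'
  proof
    show 1: "class_of R' x \<subseteq> class_of R x" using that by (rule class_of_subset_if_missing)
    show "class_of R x \<subseteq> class_of R' x"
      by (rule class_of_subset_if_missing[where Y = Y]) (use 1 that in auto)
  qed
  have "missing_pieces X R Y \<subseteq> missing_pieces X R' Y" if "R - Y \<times> Y = R' - Y \<times> Y" for R R'
    using *[OF _ that] unfolding missing_pieces_def pieces_class_of by fastforce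
  then show ?thesis using assms by (metis subset_antisym)
qed

lemma card_meeting_pieces_linked:
  assumes "Y \<subseteq> X" "Y \<noteq> {}" "\<And>x y. x \<in> Y \<Longrightarrow> y \<in> Y \<Longrightarrow> (x, y) \<in> linked R"
  shows "card (meeting_pieces X R Y) = 1"
proof -
  obtain y where y: "y \<in> Y" using assms(2) by blast
  have "meeting_pieces X R Y = {class_of R y}"
  proof
    show "meeting_pieces X R Y \<subseteq> {class_of R y}"
    proof
      fix P assume "P \<in> meeting_pieces X R Y"
      then obtain z where z: "z \<in> P" "z \<in> Y" and P: "P \<in> pieces X R"
        unfolding meeting_pieces_def by blast
      then have "P = class_of R z" by (metis piece_eq_class_of)
      also have "\<dots> = class_of R y" using assms(3)[OF z(2) y] by (simp only: class_of_eq_iff)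
      finally show "P \<in> {class_of R y}" by simp
    qed
    show "{class_of R y} \<subseteq> meeting_pieces X R Y"
      using y assms(1) self_in_class_of[of y R] unfolding meeting_pieces_def pieces_class_of by blast
  qed
  then show ?thesis by simp
qed

lemma card_pieces_le_meeting_pieces:
  assumes "finite X" "Y \<subseteq> X" "R \<subseteq> R'" "\<And>P. P \<in> pieces X R' \<Longrightarrow> P \<inter> Y \<noteq> {}"
  shows "card (pieces X R') \<le> card (meeting_pieces X R Y)"
proof (rule surj_card_le)
  show "finite (meeting_pieces X R Y)" using assms(1) by (simp add: meeting_pieces_def)
  \<comment> \<open>All points of \<open>Q\<close> have the same \<open>R'\<close>-class, so the
    union is simply the \<open>R'\<close>-piece containing \<open>Q\<close>.\<close>
  show "pieces X R' \<subseteq> (\<lambda>Q. \<Union>(class_of R' ` Q)) ` meeting_pieces X R Y"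
  proof
    fix P assume P: "P \<in> pieces X R'"
    then obtain y where y: "y \<in> P" "y \<in> Y" using assms(4) by blast
    have "class_of R' z = P" if "z \<in> class_of R y" for z
    proof -
      have "(y, z) \<in> linked R'" using that linked_mono[OF assms(3)] by (auto simp: class_of_def)
      then show ?thesis using piece_eq_class_of[OF P y(1)] by (metis class_of_eq_iff)
    qed
    moreover have "class_of R y \<noteq> {}" using self_in_class_of[of y R] by blast
    ultimately have "P = \<Union>(class_of R' ` class_of R y)" by simp
    moreover have "class_of R y \<in> meeting_pieces X R Y"
      using y assms(2) self_in_class_of[of y R] unfolding meeting_pieces_def pieces_class_of by blast
    ultimately show "P \<in> (\<lambda>Q. \<Union>(class_of R' ` Q)) ` meeting_pieces X R Y" by (rule image_eqI)
  qed
qed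

text \<open>A path starting at \<open>z\<close> in \<open>Z\<close> stays inside
  \<open>{z, m z}\<close>, so a piece uses up at most two elements of \<open>Z\<close>.\<close>

lemma card_le_pair_pieces:
  assumes "finite X" "Z \<subseteq> X" "matching Z m"
    and "\<And>u w. (u, w) \<in> R \<Longrightarrow> u \<in> Z \<or> w \<in> Z \<Longrightarrow> u \<in> Z \<and> w = m u"
  shows "card Z \<le> 2 * card (meeting_pieces X R Z)"
proof (rule card_le_two_card_pieces)
  show "meeting_pieces X R Z \<subseteq> pieces X R" by (auto simp: meeting_pieces_def)
  show "finite Z" using assms(1,2) by (rule rev_finite_subset)
  show "Z \<subseteq> \<Union>(meeting_pieces X R Z)"
  proof
    fix z assume "z \<in> Z"
    then have "class_of R z \<in> meeting_pieces X R Z"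
      using assms(2) self_in_class_of[of z R] unfolding meeting_pieces_def pieces_class_of by blast
    then show "z \<in> \<Union>(meeting_pieces X R Z)" using self_in_class_of[of z R] by blast
  qed
  fix P assume "P \<in> meeting_pieces X R Z"
  then obtain z where P: "P \<in> pieces X R" and z: "z \<in> P" "z \<in> Z" by (auto simp: meeting_pieces_def)
  have "w \<in> {z, m z}" if "w \<in> P" for w
  proof -
    have "(z, w) \<in> linked R" using piece_eq_class_of[OF P z(1)] that by (simp add: class_of_def)
    then show ?thesis
    proof (rule linked_closed)
      fix u w assume uw: "(u, w) \<in> R"
      have mz: "m z \<in> Z" "m (m z) = z" using assms(3) z by (auto simp: matching_def)
      show "u \<in> {z, m z} \<longleftrightarrow> w \<in> {z, m z}"
      proof (cases "u \<in> Z \<or> w \<in> Z")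
        case True
        with assms(4)[OF uw] have "u \<in> Z" "w = m u" by auto
        moreover from this have "m w = u" using assms(3) by (auto simp: matching_def)
        ultimately show ?thesis using mz by (metis insert_iff singletonD)
      next
        case False
        then show ?thesis using z mz by blast
      qed
    qed simp
  qed
  then have "P \<inter> Z \<subseteq> {z, m z}" by auto
  then have "card (P \<inter> Z) \<le> card {z, m z}" by (intro card_mono) auto
  also have "\<dots> \<le> 2" by (simp add: card_insert_if)
  finally show "card (P \<inter> Z) \<le> 2" .
qed (use assms in auto)

lemma matching_override_on:
  "matching X f \<Longrightarrow> matching Y f \<Longrightarrow> matching Y g \<Longrightarrow> Y \<subseteq> X \<Longrightarrow> matching X (override_on f g Y)"
  unfolding matching_def override_on_def by (smt (verit, best) subsetD)

lemma graph_on_override_on_Diff: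
  assumes "matching Y f" "matching Y g"
  shows "graph_on X (override_on f g Y) - Y \<times> Y = graph_on X f - Y \<times> Y"
  using assms by (auto simp: graph_on_def override_on_def matching_def)

text \<open>A connected graph made of two partial matchings is a path or a cycle, so it has at most two
  vertices missed by one of the matchings; the edge count shows this.\<close>

lemma exists_return_matching:
  assumes "finite X" "Y \<subseteq> X" "matching X f" "matching (X - Y) g"
  shows "\<exists>m. matching Y m \<and>
    card Y \<le> 2 * card (meeting_pieces X (graph_on X f \<union> graph_on X (override_on g m Y)) Y)"
proof -
  let ?R = "graph_on X f \<union> graph_on (X - Y) g"
  have R: "?R \<subseteq> X \<times> X" using assms(3,4) by (auto simp: graph_on_def matching_def)
  have card: "card (P \<inter> Y) \<le> 2" "even (card (P \<inter> Y))" if P: "P \<in> pieces X ?R" for P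
  proof -
    have sub: "P \<subseteq> X" using P R piece_subset by metis
    then have fin: "finite P" using assms(1) finite_subset by metis
    have mf: "matching P f" using matching_piece_even(2)[OF assms(1,3) _ R P] by auto
    have "g z \<in> P - Y" if "z \<in> P - Y" for z
    proof -
      have "(z, g z) \<in> ?R" using that sub by (auto simp: graph_on_iff)
      then have "g z \<in> P" using that P piece_closed by (metis DiffD1)
      then show ?thesis using that sub assms(4) by (auto simp: matching_def)
    qed
    then have mg: "matching (P - Y) g" using sub matching_closed_subset[OF assms(4), of "P - Y"] by blast
    obtain S1 where S1: "S1 \<subseteq> P" "P \<subseteq> S1 \<union> f ` S1" "card P = 2 * card S1"
      using matching_transversal[OF fin mf] by auto
    obtain S2 where S2: "S2 \<subseteq> P - Y" "P - Y \<subseteq> S2 \<union> g ` S2" "card (P - Y) = 2 * card S2"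
      using matching_transversal[OF _ mg] fin by auto
    have finS: "finite S1" "finite S2" using fin S1(1) S2(1) by (meson finite_Diff finite_subset)+
    \<comment> \<open>One ordered pair for each edge inside \<open>P\<close>; these still connect
      \<open>P\<close>.\<close>
    let ?E = "(\<lambda>x. (x, f x)) ` S1 \<union> (\<lambda>x. (x, g x)) ` S2"
    have E: "?E \<subseteq> P \<times> P" using S1(1) S2(1) mf mg by (auto simp: matching_def)
    have "card ?E \<le> card S1 + card S2"
      using finS by (meson add_mono card_Un_le card_image_le le_trans)
    moreover have "card P \<le> card (pieces P ?E) + card ?E"
      using card_le_card_pieces[OF fin _ E] finS by simp
    moreover have "card (pieces P ?E) \<le> 1"
    proof -
      have edge: "(u, w) \<in> linked ?E" if uw: "(u, w) \<in> ?R" "u \<in> P" for u w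
      proof -
        consider "w = f u" | "u \<in> P - Y" "w = g u"
          using uw by (auto simp: graph_on_iff)
        then show ?thesis
        proof cases
          case 1
          from S1(2) uw(2) consider "u \<in> S1" | s where "s \<in> S1" "u = f s" by blast
          then show ?thesis
          proof cases
            case (2 s)
            then have "w = s" using 1 S1(1) mf by (auto simp: matching_def)
            then show ?thesis using 2 by (intro linked_sym[OF linked_edge]) auto
          qed (use 1 in \<open>intro linked_edge, auto\<close>)
        next
          case 2
          from S2(2) 2(1) consider "u \<in> S2" | s where "s \<in> S2" "u = g s" by blast
          then show ?thesis
          proof cases
            case (2 s)
            then have "w = s" using \<open>w = g u\<close> S2(1) mg by (auto simp: matching_def)
            then show ?thesis using 2 by (intro linked_sym[OF linked_edge]) auto
          qed (use 2 in \<open>intro linked_edge, auto\<close>)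
        qed
      qed
      have "class_of ?E p = class_of ?E q" if pq: "p \<in> P" "q \<in> P" for p q
      proof -
        have "(p, q) \<in> linked ?R" using piece_eq_class_of[OF P pq(1)] pq(2) by (simp add: class_of_def)
        then have "q \<in> class_of ?E p"
        proof (rule linked_closed)
          fix u w assume uw: "(u, w) \<in> ?R"
          show "u \<in> class_of ?E p \<longleftrightarrow> w \<in> class_of ?E p"
          proof (cases "u \<in> P")
            case True
            from edge[OF uw True] show ?thesis by (rule class_of_linked)
          next
            case False
            then have "w \<notin> P" using piece_closed[OF P uw] by simp
            then show ?thesis using False class_of_subset[OF E pq(1)] by auto
          qed
        qed simp
        then show ?thesis by (simp only: in_class_of_iff)
      qed
      then have "pieces P ?E \<subseteq> {class_of ?E p}" if "p \<in> P" for p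
        using that unfolding pieces_class_of by blast
      moreover obtain p where "p \<in> P" using piece_nonempty[OF P] by auto
      ultimately have "card (pieces P ?E) \<le> card {class_of ?E p}" by (intro card_mono) auto
      then show ?thesis by simp
    qed
    moreover have "card P = card (P \<inter> Y) + card (P - Y)" using card_Int_Diff[OF fin] .
    \<comment> \<open>Connectedness gives
      \<open>card P \<le> 1 + card P / 2 + card (P - Y) / 2\<close>, which is
      \<open>card (P \<inter> Y) \<le> 2\<close>. Evenness holds because \<open>P\<close> and
      \<open>P - Y\<close> are both matched.\<close>
    ultimately show "card (P \<inter> Y) \<le> 2" "even (card (P \<inter> Y))" using S1(3) S2(3) by presburger+
  qed
  \<comment> \<open>The even number is positive, hence 2: the path starting at \<open>y\<close> ends
    at one other point of \<open>Y\<close>, which becomes \<open>m y\<close>.\<close>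
  have "\<exists>z. class_of ?R y \<inter> Y = {y, z} \<and> z \<noteq> y" if y: "y \<in> Y" for y
  proof -
    have P: "class_of ?R y \<in> pieces X ?R" using y assms(2) by (auto simp: pieces_class_of)
    have yin: "y \<in> class_of ?R y \<inter> Y" using y by simp
    have "finite (class_of ?R y \<inter> Y)" using assms(1,2) by (meson finite_Int finite_subset)
    then have "0 < card (class_of ?R y \<inter> Y)" using yin by (metis card_gt_0_iff empty_iff)
    moreover have "k = 2" if "0 < k" "k \<le> 2" "even k" for k :: nat using that by presburger
    ultimately have "card (class_of ?R y \<inter> Y) = 2" using card[OF P] by metis
    then obtain a b where "class_of ?R y \<inter> Y = {a, b}" "a \<noteq> b" by (meson card_2_iff)
    then show ?thesis using yin by (metis doubleton_eq_iff insertE singletonD)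
  qed
  then obtain m where m: "\<And>y. y \<in> Y \<Longrightarrow> class_of ?R y \<inter> Y = {y, m y} \<and> m y \<noteq> y" by metis
  have same: "class_of ?R (m y) = class_of ?R y" if "y \<in> Y" for y
    using m[OF that] in_class_of_iff[of "m y" ?R y] by blast
  have "matching Y m"
    unfolding matching_def
  proof
    fix y assume y: "y \<in> Y"
    have my: "m y \<in> Y" using m[OF y] by blast
    then have "{m y, m (m y)} = {y, m y}" "m (m y) \<noteq> m y" using m[OF y] m[OF my] same[OF y] by auto
    then show "m y \<in> Y \<and> m y \<noteq> y \<and> m (m y) = y" using my m[OF y] by (auto simp: doubleton_eq_iff)
  qed
  moreover
  let ?S = "graph_on X f \<union> graph_on X (override_on g m Y)"
  \<comment> \<open>The edges of \<open>m\<close> only close paths into cycles, joining points that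
    are already linked.\<close>
  have "pieces X ?S = pieces X ?R"
  proof (rule pieces_cong, rule linked_eqI)
    show "?S \<subseteq> linked ?R"
    proof
      fix e assume "e \<in> ?S"
      then consider "e \<in> ?R" | y where "y \<in> Y" "e = (y, m y)"
        unfolding graph_on_def override_on_def by fastforce
      then show "e \<in> linked ?R"
      proof cases
        case 1
        then show ?thesis using subset_linked[of ?R] by blast
      next
        case 2
        then show ?thesis using same[of y] by (simp add: class_of_eq_iff[symmetric])
      qed
    qed
    have "?R \<subseteq> ?S" by (auto simp: graph_on_def override_on_def)
    then show "?R \<subseteq> linked ?S" using subset_linked[of ?S] by blast
  qed
  then have "card Y \<le> 2 * card (meeting_pieces X ?S Y)"
  proof (intro card_le_two_card_pieces[of _ X ?R])
    assume eq: "pieces X ?S = pieces X ?R"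
    show "meeting_pieces X ?S Y \<subseteq> pieces X ?R" using eq by (auto simp: meeting_pieces_def)
    show "Y \<subseteq> \<Union>(meeting_pieces X ?S Y)"
    proof
      fix y assume "y \<in> Y"
      then have "class_of ?S y \<in> meeting_pieces X ?S Y"
        using assms(2) self_in_class_of[of y ?S] unfolding meeting_pieces_def pieces_class_of by blast
      then show "y \<in> \<Union>(meeting_pieces X ?S Y)" using self_in_class_of[of y ?S] by blast
    qed
    show "\<And>P. P \<in> meeting_pieces X ?S Y \<Longrightarrow> card (P \<inter> Y) \<le> 2"
      using eq card(1) by (auto simp: meeting_pieces_def)
    show "finite Y" using assms(1,2) finite_subset by metis
  qed (use assms in auto)
  ultimately show ?thesis by blast
qed

subsection \<open>Cuts consisting of two arcs\<close>

lemma linked_if_card_pieces_1: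
  assumes "card (pieces X R) = 1" "x \<in> X" "y \<in> X" shows "(x, y) \<in> linked R"
proof -
  have "class_of R x \<in> pieces X R" "class_of R y \<in> pieces X R"
    using assms by (auto simp: pieces_class_of)
  then have "class_of R x = class_of R y" using assms(1) by (auto simp: card_1_singleton_iff)
  then show ?thesis by (simp add: class_of_eq_iff)
qed

lemma matching_mem_iff:
  assumes "matching X f" "matching Y f" "u \<in> X" shows "f u \<in> Y \<longleftrightarrow> u \<in> Y"
  using assms unfolding matching_def by metis

abbreviation cyc :: "'b set \<Rightarrow> ('b \<Rightarrow> 'b) \<Rightarrow> ('b \<Rightarrow> 'b) \<Rightarrow> nat" where
  "cyc X f g \<equiv> card (pieces X (graph_on X f \<union> graph_on X g))"

context
  fixes X Y :: "'b set" and a t g :: "'b \<Rightarrow> 'b"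
  assumes X: "finite X" "matching X a" "matching X t" "matching X g"
    and Y: "Y \<subseteq> X" "Y \<noteq> {}" "matching Y t" "matching Y g"
    and Y_linked: "\<And>x y. x \<in> Y \<Longrightarrow> y \<in> Y \<Longrightarrow> (x, y) \<in> linked (graph_on X t \<union> graph_on X g)"
begin

text \<open>The genus inequality for \<open>a\<close>, \<open>t\<close>, \<open>t'\<close>. Off
  \<open>Y\<close> the matchings \<open>t\<close> and \<open>t'\<close> agree, so each edge there is
  a cycle of its own, and \<open>Y\<close> is one further cycle. All components meeting
  \<open>Y\<close> coincide, which leaves one plus those of \<open>a\<close> and \<open>t\<close>
  that avoid \<open>Y\<close>.\<close>

lemma cyc_exchange_le:
  defines "t' \<equiv> override_on t g Y"
  shows "2 * (cyc X a t + cyc X a t') + card (X - Y)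
    \<le> card X + 4 * card (missing_pieces X (graph_on X a \<union> graph_on X t) Y) + 2"
proof -
  have t': "matching X t'" unfolding t'_def using X Y by (intro matching_override_on)
  let ?R = "graph_on X t \<union> graph_on X t'"
  have ov: "graph_on X t' - Y \<times> Y = graph_on X t - Y \<times> Y"
    unfolding t'_def by (rule graph_on_override_on_Diff[OF Y(3,4)])
  have linked: "(x, y) \<in> linked ?R" if xy: "x \<in> Y" "y \<in> Y" for x y
  proof -
    have "y \<in> Y \<inter> class_of ?R x"
    proof (rule linked_closed[OF Y_linked[OF xy]])
      fix u w assume uw: "(u, w) \<in> graph_on X t \<union> graph_on X g"
      then have mem: "u \<in> X" "w = t u \<or> w = g u" by (auto simp: graph_on_iff)
      have "u \<in> Y \<longleftrightarrow> w \<in> Y"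
        using mem matching_mem_iff[OF X(3) Y(3) mem(1)] matching_mem_iff[OF X(4) Y(4) mem(1)] by auto
      moreover have "(u, w) \<in> ?R" if "u \<in> Y"
        using mem that by (auto simp: graph_on_iff t'_def)
      ultimately show "u \<in> Y \<inter> class_of ?R x \<longleftrightarrow> w \<in> Y \<inter> class_of ?R x"
        using class_of_closed[of u w ?R x] by blast
    qed (use xy in simp)
    then show ?thesis by (simp add: class_of_def)
  qed
  have linked': "(x, y) \<in> linked (graph_on X a \<union> ?R)" if "x \<in> Y" "y \<in> Y" for x y
    using linked[OF that] linked_mono[of ?R "graph_on X a \<union> ?R"] by blast
  have "missing_pieces X (graph_on X a \<union> ?R) Y = missing_pieces X (graph_on X a \<union> graph_on X t) Y"
    using ov by (intro missing_pieces_cong) auto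
  then have k: "card (pieces X (graph_on X a \<union> ?R))
      = card (missing_pieces X (graph_on X a \<union> graph_on X t) Y) + 1"
    using card_pieces_split[OF X(1), of "graph_on X a \<union> ?R" Y]
      card_meeting_pieces_linked[OF Y(1,2) linked'] by simp
  have "card (X - Y) \<le> 2 * card (meeting_pieces X ?R (X - Y))"
  proof (rule card_le_pair_pieces[OF X(1) _ matching_Diff[OF X(3) Y(3)]])
    fix u w assume "(u, w) \<in> ?R" "u \<in> X - Y \<or> w \<in> X - Y"
    then have *: "u \<in> X" "w = t u \<or> w = t' u" "u \<notin> Y \<or> w \<notin> Y" by (auto simp: graph_on_iff)
    have "u \<notin> Y"
    proof
      assume "u \<in> Y"
      then have "t u \<in> Y" "t' u \<in> Y" using Y(3,4) by (auto simp: matching_def t'_def)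
      then show False using * \<open>u \<in> Y\<close> by auto
    qed
    then show "u \<in> X - Y \<and> w = t u" using * by (auto simp: t'_def)
  qed simp
  also have "card (meeting_pieces X ?R (X - Y)) \<le> card (missing_pieces X ?R Y)"
  proof (rule card_mono)
    show "finite (missing_pieces X ?R Y)" using X(1) by (simp add: missing_pieces_def)
    show "meeting_pieces X ?R (X - Y) \<subseteq> missing_pieces X ?R Y"
    proof
      fix P assume "P \<in> meeting_pieces X ?R (X - Y)"
      then obtain z where P: "P \<in> pieces X ?R" and z: "z \<in> P" "z \<in> X - Y"
        unfolding meeting_pieces_def by blast
      have "P \<inter> Y = {}"
      proof (rule ccontr)
        assume "P \<inter> Y \<noteq> {}"
        then obtain y where y: "y \<in> P" "y \<in> Y" by blast
        have "(y, z) \<in> linked ?R" using piece_eq_class_of[OF P y(1)] z by (simp add: class_of_def)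
        then have "z \<in> Y"
        proof (rule linked_closed)
          fix u w assume "(u, w) \<in> ?R"
          then have *: "u \<in> X" "w = t u \<or> w = t' u" by (auto simp: graph_on_iff)
          then show "u \<in> Y \<longleftrightarrow> w \<in> Y"
            using matching_mem_iff[OF X(3) Y(3) *(1)] matching_mem_iff[OF X(4) Y(4) *(1)]
            by (auto simp: t'_def override_on_def split: if_splits)
        qed (rule y)
        then show False using z by blast
      qed
      then show "P \<in> missing_pieces X ?R Y" using P by (simp add: missing_pieces_def)
    qed
  qed
  finally have "card (X - Y) + 2 \<le> 2 * cyc X t t'"
    using card_pieces_split[OF X(1), of ?R Y] card_meeting_pieces_linked[OF Y(1,2) linked] by simp
  then show ?thesis using euler_inequality[OF X(1,2,3) t'] k by simp
qed

end

text \<open>The graph of the three matchings is drawn on a surface in which the cycles of any two of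
  them bound discs. Exchanging \<open>t\<close> and \<open>g\<close> on \<open>Y\<close> is the partial dual
  at one hyperedge.\<close>

theorem exists_two_arc_cut:
  assumes X: "finite X" "matching X a" "matching X t" "matching X g"
    and Y: "Y \<subseteq> X" "Y \<noteq> {}" "Y \<noteq> X" "matching Y t" "matching Y g"
    and Y_linked: "\<And>x y. x \<in> Y \<Longrightarrow> y \<in> Y \<Longrightarrow> (x, y) \<in> linked (graph_on X t \<union> graph_on X g)"
    and conn: "card (pieces X (graph_on X a \<union> (graph_on X t \<union> graph_on X g))) = 1"
    and plane: "card X + 4 \<le> 2 * (cyc X a t + cyc X a g + cyc X t g)"
    and plane': "card X + 4 \<le> 2 * (cyc X a (override_on t g Y) + cyc X a (override_on g t Y) + cyc X t g)"
  obtains C y y' where "C \<subseteq> X - Y" "matching C t" "matching C g" "y \<in> C" "y' \<in> C" "y \<noteq> y'"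
    "a y \<notin> C" "a y' \<notin> C" "\<And>z. z \<in> C \<Longrightarrow> z \<noteq> y \<Longrightarrow> z \<noteq> y' \<Longrightarrow> a z \<in> C"
proof -
  have fin: "finite Y" using X(1) Y(1) finite_subset by metis
  have card: "card X = card Y + card (X - Y)"
    using card_Int_Diff[OF X(1), of Y] Y(1) by (simp add: Int_absorb1)
  let ?A = "card (missing_pieces X (graph_on X a \<union> graph_on X t) Y)"
  let ?B = "card (missing_pieces X (graph_on X a \<union> graph_on X g) Y)"
  have Y_linked': "(x, y) \<in> linked (graph_on X g \<union> graph_on X t)" if "x \<in> Y" "y \<in> Y" for x y
    using Y_linked[OF that] by (simp add: Un_commute)
  \<comment> \<open>Sum of the two exchange inequalities, with all four cycle counts involving
    \<open>a\<close> eliminated by \<open>plane\<close> and \<open>plane'\<close>. This is the lower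
    bound for \<open>?A + ?B\<close>.\<close>
  have E12: "card (X - Y) + 2 \<le> 2 * cyc X t g + 2 * ?A + 2 * ?B"
  proof -
    have "2 * (cyc X a t + cyc X a (override_on t g Y)) + card (X - Y) \<le> card X + 4 * ?A + 2"
      by (rule cyc_exchange_le[OF X Y(1,2,4,5)]) (rule Y_linked)
    moreover have "2 * (cyc X a g + cyc X a (override_on g t Y)) + card (X - Y) \<le> card X + 4 * ?B + 2"
      by (rule cyc_exchange_le[OF X(1,2,4,3) Y(1,2,5,4)]) (rule Y_linked')
    ultimately show ?thesis using plane plane' by simp
  qed
  \<comment> \<open>From an end in \<open>Y\<close>, follow \<open>a\<close>, then alternately
    \<open>t\<close> and \<open>a\<close> outside \<open>Y\<close>; \<open>m\<close> gives the end
    where this walk returns to \<open>Y\<close>.\<close>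
  obtain m where m: "matching Y m"
    and m_card: "card Y \<le> 2 * card (meeting_pieces X (graph_on X a \<union> graph_on X (override_on t m Y)) Y)"
    using exists_return_matching[OF X(1) Y(1) X(2) matching_Diff[OF X(3) Y(4)]] by blast
  define s where "s = override_on t m Y"
  define r where "r = override_on g m Y"
  have sr: "matching X s" "matching X r"
    unfolding s_def r_def using X Y m by (auto intro!: matching_override_on)
  have ov: "graph_on X s - Y \<times> Y = graph_on X t - Y \<times> Y" "graph_on X r - Y \<times> Y = graph_on X g - Y \<times> Y"
    unfolding s_def r_def using graph_on_override_on_Diff Y m by metis+
  let ?U = "graph_on X a \<union> (graph_on X s \<union> graph_on X r)"
  have U: "?U \<subseteq> X \<times> X" using sr X(2) graph_on_subset by (metis Un_least)
  have miss: "missing_pieces X (graph_on X a \<union> graph_on X s) Y = missing_pieces X (graph_on X a \<union> graph_on X t) Y"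
    "missing_pieces X (graph_on X a \<union> graph_on X r) Y = missing_pieces X (graph_on X a \<union> graph_on X g) Y"
    "missing_pieces X (graph_on X s \<union> graph_on X r) Y = missing_pieces X (graph_on X t \<union> graph_on X g) Y"
    "missing_pieces X ?U Y = missing_pieces X (graph_on X a \<union> (graph_on X t \<union> graph_on X g)) Y"
    using ov by (intro missing_pieces_cong; blast)+
  \<comment> \<open>A piece avoiding \<open>Y\<close> would also be a piece of the original graph,
    which is connected and meets \<open>Y\<close>.\<close>
  have all_meet: "P \<inter> Y \<noteq> {}" if P: "P \<in> pieces X ?U" for P
  proof
    assume "P \<inter> Y = {}"
    then have "P \<in> missing_pieces X (graph_on X a \<union> (graph_on X t \<union> graph_on X g)) Y"
      using P miss(4) by (auto simp: missing_pieces_def)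
    moreover have "card (meeting_pieces X (graph_on X a \<union> (graph_on X t \<union> graph_on X g)) Y) = 1"
      using Y(1) linked_if_card_pieces_1[OF conn] by (intro card_meeting_pieces_linked Y(1,2)) auto
    then have "card (missing_pieces X (graph_on X a \<union> (graph_on X t \<union> graph_on X g)) Y) = 0"
      using card_pieces_split[OF X(1), of "graph_on X a \<union> (graph_on X t \<union> graph_on X g)" Y] conn by simp
    moreover have "finite (missing_pieces X (graph_on X a \<union> (graph_on X t \<union> graph_on X g)) Y)"
      using X(1) by (simp add: missing_pieces_def)
    ultimately show False by (metis card_0_eq empty_iff)
  qed
  \<comment> \<open>Every pair of \<open>m\<close> closes its own return path, contributing
    \<open>card Y / 2\<close> cycles besides those that avoid \<open>Y\<close>.\<close>
  have c1: "2 * ?A + card Y \<le> 2 * cyc X a s"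
    using card_pieces_split[OF X(1), of "graph_on X a \<union> graph_on X s" Y] miss(1) m_card
    unfolding s_def by simp
  \<comment> \<open>The cycles of \<open>a\<close> and \<open>r\<close> that meet \<open>Y\<close>
    are only estimated by one for each component of \<open>?U\<close>.\<close>
  have c2: "?B + card (pieces X ?U) \<le> cyc X a r"
  proof -
    have "card (pieces X ?U) \<le> card (meeting_pieces X (graph_on X a \<union> graph_on X r) Y)"
      using all_meet by (intro card_pieces_le_meeting_pieces[OF X(1) Y(1)]) auto
    then show ?thesis
      using card_pieces_split[OF X(1), of "graph_on X a \<union> graph_on X r" Y] miss(2) by simp
  qed
  \<comment> \<open>On \<open>Y\<close> both matchings are \<open>m\<close>, so the single cycle of
    \<open>t\<close> and \<open>g\<close> on \<open>Y\<close> gives way to \<open>card Y / 2\<close>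
    two-element cycles. The lost cycle is the summand 2 in \<open>c3\<close>.\<close>
  have "card Y \<le> 2 * card (meeting_pieces X (graph_on X s \<union> graph_on X r) Y)"
  proof (rule card_le_pair_pieces[OF X(1) Y(1) m])
    fix u w assume "(u, w) \<in> graph_on X s \<union> graph_on X r" "u \<in> Y \<or> w \<in> Y"
    then have *: "u \<in> X" "w = s u \<or> w = r u" "u \<in> Y \<or> w \<in> Y" by (auto simp: graph_on_iff)
    then have "u \<in> Y"
      using matching_mem_iff[OF X(3) Y(4) *(1)] matching_mem_iff[OF X(4) Y(5) *(1)]
      by (auto simp: s_def r_def override_on_def split: if_splits)
    then show "u \<in> Y \<and> w = m u" using * by (auto simp: s_def r_def)
  qed
  moreover have "card (meeting_pieces X (graph_on X t \<union> graph_on X g) Y) = 1"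
    by (rule card_meeting_pieces_linked[OF Y(1,2) Y_linked])
  ultimately have c3: "2 * cyc X t g + card Y \<le> 2 * cyc X s r + 2"
    using card_pieces_split[OF X(1), of "graph_on X s \<union> graph_on X r" Y]
      card_pieces_split[OF X(1), of "graph_on X t \<union> graph_on X g" Y] miss(3) by simp
  have K: "card Y \<le> 2 * card (pieces X ?U)"
  proof -
    \<comment> \<open>Here \<open>p\<close>, \<open>q\<close>, \<open>u\<close> count the cycles of
      \<open>a s\<close>, \<open>s r\<close>, \<open>a r\<close>; \<open>i\<close>, \<open>j\<close>
      are \<open>?A\<close>, \<open>?B\<close>; \<open>e\<close> is \<open>cyc X t g\<close>; and
      \<open>n\<close>, \<open>y\<close>, \<open>d\<close> are the sizes of \<open>X\<close>,
      \<open>Y\<close>, \<open>X - Y\<close>.\<close>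
    have arith: "y \<le> 2 * k" if "2 * (p + q + u) \<le> n + 4 * k" "2 * i + y \<le> 2 * p" "j + k \<le> u"
      "2 * e + y \<le> 2 * q + 2" "d + 2 \<le> 2 * e + 2 * i + 2 * j" "n = y + d"
      for p q u n k i j y e d :: nat using that by simp
    show ?thesis by (rule arith[OF euler_inequality[OF X(1,2) sr] c1 c2 c3 E12 card])
  qed
  have m_in: "m z \<in> P" if "P \<in> pieces X ?U" "z \<in> P" "z \<in> Y" for P z
  proof -
    have "(z, m z) \<in> ?U" using that(3) Y(1) by (auto simp: graph_on_iff s_def)
    then show ?thesis using that(1,2) piece_closed by metis
  qed
  have two: "card (P \<inter> Y) = 2" if "P \<in> pieces X ?U" for P
  proof (rule card_piece_eq_two[OF subset_refl X(1) fin _ K that])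
    fix Q assume Q: "Q \<in> pieces X ?U"
    then obtain z where z: "z \<in> Q" "z \<in> Y" using all_meet by blast
    then have "m z \<in> Q \<inter> Y" "m z \<noteq> z" using m_in[OF Q z] m by (auto simp: matching_def)
    moreover have "finite (Q \<inter> Y)" using fin by simp
    ultimately show "2 \<le> card (Q \<inter> Y)" using two_le_card[of "Q \<inter> Y" z "m z"] z by auto
  qed
  \<comment> \<open>If no arc left \<open>Y\<close>, connectedness would give
    \<open>Y = X\<close>.\<close>
  obtain x where x: "x \<in> Y" "a x \<notin> Y"
  proof (rule ccontr)
    assume "\<not> thesis"
    then have aY: "\<And>x. x \<in> Y \<Longrightarrow> a x \<in> Y" using that by blast
    obtain y where y: "y \<in> Y" using Y(2) by blast
    have "X \<subseteq> Y"
    proof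
      fix z assume "z \<in> X"
      then have "(y, z) \<in> linked (graph_on X a \<union> (graph_on X t \<union> graph_on X g))"
        using linked_if_card_pieces_1[OF conn] y Y(1) by blast
      then show "z \<in> Y"
      proof (rule linked_closed)
        fix u w assume "(u, w) \<in> graph_on X a \<union> (graph_on X t \<union> graph_on X g)"
        then have *: "u \<in> X" "w = a u \<or> w = t u \<or> w = g u" by (auto simp: graph_on_iff)
        have "a u \<in> Y \<longleftrightarrow> u \<in> Y" using aY[of u] aY[of "a u"] *(1) X(2) by (auto simp: matching_def)
        then show "u \<in> Y \<longleftrightarrow> w \<in> Y"
          using *(2) matching_mem_iff[OF X(3) Y(4) *(1)] matching_mem_iff[OF X(4) Y(5) *(1)] by auto
      qed (rule y)
    qed
    then show False using Y by blast
  qed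
  define P where "P = class_of ?U x"
  have P: "P \<in> pieces X ?U" using x Y(1) by (auto simp: P_def pieces_class_of)
  have PX: "P \<subseteq> X" using P U piece_subset by metis
  have xP: "x \<in> P" by (simp add: P_def)
  have mx: "m x \<in> P" "m x \<in> Y" "m x \<noteq> x" using m_in[OF P xP x(1)] m x(1) by (auto simp: matching_def)
  have PY: "P \<inter> Y = {x, m x}"
  proof (rule card_seteq[symmetric])
    show "finite (P \<inter> Y)" using fin by simp
    show "{x, m x} \<subseteq> P \<inter> Y" using mx x xP by blast
    show "card (P \<inter> Y) \<le> card {x, m x}" using two[OF P] mx(3) by simp
  qed
  have aP: "a z \<in> P" "a (a z) = z" if "z \<in> P" for z
  proof -
    have "(z, a z) \<in> ?U" using that PX by (auto simp: graph_on_iff)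
    then show "a z \<in> P" using that piece_closed[OF P] by metis
    show "a (a z) = z" using that PX X(2) by (auto simp: matching_def)
  qed
  have srP: "s z \<in> P" "r z \<in> P" if "z \<in> P" for z
  proof -
    have "(z, s z) \<in> ?U" "(z, r z) \<in> ?U" using that PX by (auto simp: graph_on_iff)
    then show "s z \<in> P" "r z \<in> P" using that piece_closed[OF P] by metis+
  qed
  \<comment> \<open>An arc from \<open>m x\<close> into \<open>Y\<close> would stay in
    \<open>P\<close>, so it would end at \<open>x\<close>; but \<open>a x\<close> is outside
    \<open>Y\<close>.\<close>
  have amx: "a (m x) \<notin> Y"
  proof
    assume "a (m x) \<in> Y"
    then have "a (m x) \<in> {x, m x}" using aP(1)[OF mx(1)] PY by blast
    moreover have "a (m x) \<noteq> m x" using mx(1) PX X(2) by (auto simp: matching_def)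
    ultimately have "a x = m x" using aP(2)[OF mx(1)] by auto
    then show False using x mx by simp
  qed
  have tg: "t z \<in> P - Y" "g z \<in> P - Y" if "z \<in> P - Y" for z
  proof -
    have "t z = s z" "g z = r z" using that by (auto simp: s_def r_def)
    moreover have "t z \<notin> Y" "g z \<notin> Y"
      using that PX matching_mem_iff[OF X(3) Y(4), of z] matching_mem_iff[OF X(4) Y(5), of z] by auto
    ultimately show "t z \<in> P - Y" "g z \<in> P - Y" using srP that by auto
  qed
  show ?thesis
  \<comment> \<open>The cut separates the component \<open>P\<close> from its two ends
    \<open>x\<close> and \<open>m x\<close> on the hyperedge; the arcs at these ends are the only
    ones leaving \<open>P - Y\<close>.\<close>
  proof (rule that[of "P - Y" "a x" "a (m x)"])
    show "P - Y \<subseteq> X - Y" using PX by blast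
    have sub: "P - Y \<subseteq> X" using PX by blast
    show "matching (P - Y) t" by (rule matching_closed_subset[OF X(3) sub tg(1)])
    show "matching (P - Y) g" by (rule matching_closed_subset[OF X(4) sub tg(2)])
    show "a x \<in> P - Y" "a (m x) \<in> P - Y" using aP(1) xP mx(1) x(2) amx by auto
    show "a x \<noteq> a (m x)" using aP(2)[OF xP] aP(2)[OF mx(1)] mx(3) by metis
    show "a (a x) \<notin> P - Y" "a (a (m x)) \<notin> P - Y"
      using aP(2)[OF xP] aP(2)[OF mx(1)] x(1) mx(2) by auto
    fix z assume z: "z \<in> P - Y" "z \<noteq> a x" "z \<noteq> a (m x)"
    have "a z \<noteq> x" "a z \<noteq> m x" using z aP(2)[of z] by auto
    then show "a z \<in> P - Y" using aP(1)[of z] z PY by blast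
  qed
qed

subsection \<open>Hypermaps as triples of matchings\<close>

lemma linked_Un_cong:
  assumes "linked R = linked R'" "linked S = linked S'" shows "linked (R \<union> S) = linked (R' \<union> S')"
proof (rule linked_eqI)
  have "linked R' \<subseteq> linked (R' \<union> S')" "linked S' \<subseteq> linked (R' \<union> S')"
    "linked R \<subseteq> linked (R \<union> S)" "linked S \<subseteq> linked (R \<union> S)" by (intro linked_mono; blast)+
  then show "R \<union> S \<subseteq> linked (R' \<union> S')" "R' \<union> S' \<subseteq> linked (R \<union> S)"
    using assms subset_linked[of R] subset_linked[of S] subset_linked[of R'] subset_linked[of S'] by auto
qed

lemma linked_map: "(x, y) \<in> linked R \<Longrightarrow> (f x, f y) \<in> linked (map_prod f f ` R)"
proof -
  assume "(x, y) \<in> linked R"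
  then have "y \<in> {y. f y \<in> class_of (map_prod f f ` R) (f x)}"
  proof (rule linked_closed)
    fix u w assume "(u, w) \<in> R"
    then have "(f u, f w) \<in> map_prod f f ` R" by force
    from class_of_closed[OF this]
    show "u \<in> {y. f y \<in> class_of (map_prod f f ` R) (f x)} \<longleftrightarrow> w \<in> {y. f y \<in> class_of (map_prod f f ` R) (f x)}"
      by simp
  qed simp
  then show ?thesis by (simp add: class_of_def)
qed

lemma card_pieces_map:
  assumes "bij f" "f ` X = X"
  shows "card (pieces X (map_prod f f ` R)) = card (pieces X R)"
proof -
  let ?S = "map_prod f f ` R"
  have inv: "map_prod (inv f) (inv f) ` ?S = R"
    using assms(1) by (force simp: image_image bij_is_inj)
  have "class_of ?S (f x) = f ` class_of R x" for x
  proof (intro set_eqI iffI)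
    fix z assume "z \<in> class_of ?S (f x)"
    then have "(inv f (f x), inv f z) \<in> linked (map_prod (inv f) (inv f) ` ?S)"
      by (intro linked_map) (simp add: class_of_def)
    then have "inv f z \<in> class_of R x" unfolding inv using assms(1) by (simp add: class_of_def bij_is_inj)
    moreover have "f (inv f z) = z" using assms(1) by (simp add: bij_is_surj surj_f_inv_f)
    ultimately show "z \<in> f ` class_of R x" by (metis imageI)
  next
    fix z assume "z \<in> f ` class_of R x"
    then show "z \<in> class_of ?S (f x)" by (auto simp: class_of_def intro: linked_map)
  qed
  then have "pieces (f ` X) ?S = (`) f ` pieces X R"
    by (simp add: pieces_class_of image_image)
  moreover have "inj_on ((`) f) (pieces X R)"
    using assms(1) by (meson bij_is_inj inj_image_eq_iff inj_onI)
  ultimately show ?thesis using assms(2) by (simp add: card_image)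
qed

primrec label :: "'a arrow_end \<Rightarrow> 'a" where
  "label (Tail a) = a"
| "label (Head a) = a"

text \<open>\<open>gap_rel\<close> completed to an involution: the gap at the tail of
  \<open>a\<close> starts at the head of the preceding arrow.\<close>

primrec gap_end :: "'a arrow_presentation \<Rightarrow> 'a arrow_end \<Rightarrow> 'a arrow_end" where
  "gap_end H (Tail a) = Head (inv (next_arrow H) a)"
| "gap_end H (Head a) = Tail (next_arrow H a)"

lemma in_ends_of_iff: "x \<in> ends_of B \<longleftrightarrow> label x \<in> B"
  by (cases x) (auto simp: ends_of_def)

lemma inj_ends_of: "inj ends_of"
proof (rule injI)
  fix A B :: "'a set" assume "ends_of A = ends_of B"
  then have "Tail a \<in> ends_of A \<longleftrightarrow> Tail a \<in> ends_of B" for a by simp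
  then show "A = B" by (auto simp: in_ends_of_iff)
qed

lemma card_ends_of: "finite B \<Longrightarrow> card (ends_of B) = 2 * card B"
  unfolding ends_of_def by (subst card_Un_disjoint) (auto simp: card_image inj_on_def)

lemma finite_ends_of: "finite B \<Longrightarrow> finite (ends_of B)"
  by (simp add: ends_of_def)

lemma label_other_end [simp]: "label (other_end x) = label x" "other_end (other_end x) = x" "other_end x \<noteq> x"
  by (cases x; simp)+

lemma matching_other_end: "matching (ends_of B) other_end"
  by (simp add: matching_def in_ends_of_iff)

context
  fixes H :: "'a arrow_presentation"
  assumes H: "ribbon_hypermap H"
begin

lemma finite_arrows: "finite (arrows H)"
  and next_permutes: "next_arrow H permutes arrows H"
  and curve_arc_permutes: "curve_arc H permutes ends H"
  using H by (auto simp: ribbon_hypermap_def)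

lemma matching_curve_arc: "matching (ends H) (curve_arc H)"
  using H by (simp add: matching_def ribbon_hypermap_def permutes_in_image)

lemma next_inv [simp]: "next_arrow H (inv (next_arrow H) a) = a" "inv (next_arrow H) (next_arrow H a) = a"
  using next_permutes by (simp_all add: permutes_inverses)

lemma next_in_arrows [simp]: "next_arrow H a \<in> arrows H \<longleftrightarrow> a \<in> arrows H"
  "inv (next_arrow H) a \<in> arrows H \<longleftrightarrow> a \<in> arrows H"
  using next_permutes permutes_inv[OF next_permutes] by (simp_all add: permutes_in_image)

lemma matching_gap_end:
  assumes "\<And>a. next_arrow H a \<in> B \<longleftrightarrow> a \<in> B" shows "matching (ends_of B) (gap_end H)"
  unfolding matching_def
proof
  fix x assume "x \<in> ends_of B"
  moreover have "inv (next_arrow H) a \<in> B \<longleftrightarrow> a \<in> B" for a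
    using assms[of "inv (next_arrow H) a"] by simp
  ultimately show "gap_end H x \<in> ends_of B \<and> gap_end H x \<noteq> x \<and> gap_end H (gap_end H x) = x"
    using assms by (cases x) (auto simp: in_ends_of_iff)
qed

text \<open>Alternating arrows and gaps walks around the boundary of a hyperedge and visits both
  ends of all its arrows.\<close>

lemma pieces_arrow_gap:
  "pieces (ends H) (graph_on (ends H) other_end \<union> graph_on (ends H) (gap_end H)) = ends_of ` hyperedges H"
proof -
  let ?R = "graph_on (ends H) other_end \<union> graph_on (ends H) (gap_end H)"
  let ?E = "{(a, next_arrow H a) | a. a \<in> arrows H}"
  have E: "?E \<subseteq> arrows H \<times> arrows H" by auto
  have Tail: "(Tail (label x), x) \<in> linked ?R" if "x \<in> ends H" for x
  proof (cases x)
    case (Head b)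
    then show ?thesis using that by (auto intro!: linked_edge simp: graph_on_iff in_ends_of_iff)
  qed simp
  have "class_of ?R x = ends_of (class_of ?E (label x))" if x: "x \<in> ends H" for x
  proof (intro set_eqI iffI)
    fix y assume "y \<in> class_of ?R x"
    then have "(x, y) \<in> linked ?R" by (simp add: class_of_def)
    then show "y \<in> ends_of (class_of ?E (label x))"
    proof (rule linked_closed)
      fix u w assume "(u, w) \<in> ?R"
      then have u: "label u \<in> arrows H" "w = other_end u \<or> w = gap_end H u"
        by (auto simp: graph_on_iff in_ends_of_iff)
      then have "label w = label u \<or> (label u, label w) \<in> ?E \<or> (label w, label u) \<in> ?E"
        by (cases u) auto
      then show "u \<in> ends_of (class_of ?E (label x)) \<longleftrightarrow> w \<in> ends_of (class_of ?E (label x))"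
        unfolding in_ends_of_iff
      proof (elim disjE)
        let ?C = "class_of ?E (label x)"
        show "label w = label u \<Longrightarrow> label u \<in> ?C \<longleftrightarrow> label w \<in> ?C" by simp
        show "(label u, label w) \<in> ?E \<Longrightarrow> label u \<in> ?C \<longleftrightarrow> label w \<in> ?C" by (rule class_of_closed)
        show "(label w, label u) \<in> ?E \<Longrightarrow> label u \<in> ?C \<longleftrightarrow> label w \<in> ?C" by (rule class_of_closed[symmetric])
      qed
    qed (simp add: in_ends_of_iff)
  next
    fix y assume "y \<in> ends_of (class_of ?E (label x))"
    then have y: "label y \<in> class_of ?E (label x)" by (simp add: in_ends_of_iff)
    have "class_of ?E (label x) \<subseteq> arrows H"
      using class_of_subset[OF E] x by (simp add: in_ends_of_iff)
    then have "y \<in> ends H" using y by (auto simp: in_ends_of_iff)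
    then have yx: "(Tail (label y), y) \<in> linked ?R" "(x, Tail (label x)) \<in> linked ?R"
      using Tail x linked_sym by metis+
    have "(label x, label y) \<in> linked ?E" using y by (simp add: class_of_def)
    then have "label y \<in> {b. Tail b \<in> class_of ?R x}"
    proof (rule linked_closed)
      show "label x \<in> {b. Tail b \<in> class_of ?R x}" using yx by (simp add: class_of_def)
      fix u w assume uw: "(u, w) \<in> ?E"
      then have "(Tail u, Head u) \<in> ?R" "(Head u, Tail w) \<in> ?R"
        by (auto simp: graph_on_iff in_ends_of_iff)
      from this[THEN class_of_closed]
      show "u \<in> {b. Tail b \<in> class_of ?R x} \<longleftrightarrow> w \<in> {b. Tail b \<in> class_of ?R x}"
        by (simp only: mem_Collect_eq)
    qed
    then show "y \<in> class_of ?R x" using class_of_linked[OF yx(1)] by simp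
  qed
  then have "pieces (ends H) ?R = (\<lambda>x. ends_of (class_of ?E (label x))) ` ends H"
    unfolding pieces_class_of by (rule image_cong[OF refl])
  also have "\<dots> = ends_of ` class_of ?E ` label ` ends H" by (simp only: image_image)
  also have "label ` ends H = arrows H" by (force simp: ends_of_def)
  finally show ?thesis unfolding hyperedges_def pieces_class_of .
qed

lemma num_hyperedges_eq: "num_hyperedges H = cyc (ends H) other_end (gap_end H)"
  unfolding num_hyperedges_def pieces_arrow_gap
  using inj_ends_of by (metis card_image inj_on_subset subset_UNIV)

lemma hyperedges_subset: "e \<in> hyperedges H \<Longrightarrow> e \<subseteq> arrows H"
  unfolding hyperedges_def by (rule piece_subset) auto

lemma hyperedge_closed:
  assumes "e \<in> hyperedges H" shows "next_arrow H a \<in> e \<longleftrightarrow> a \<in> e"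
proof (cases "a \<in> arrows H")
  case True
  then have "(a, next_arrow H a) \<in> {(a, next_arrow H a) | a. a \<in> arrows H}" by blast
  from piece_closed[OF assms[unfolded hyperedges_def] this] show ?thesis by simp
next
  case False
  from permutes_not_in[OF next_permutes this] show ?thesis by simp
qed

lemma total_degree_eq: "total_degree H = card (arrows H)"
proof -
  let ?E = "{(a, next_arrow H a) | a. a \<in> arrows H}"
  have U: "\<Union>(hyperedges H) = arrows H" unfolding hyperedges_def by (rule Union_pieces) auto
  have "total_degree H = (\<Sum>e\<in>hyperedges H. card (e \<inter> arrows H))"
    unfolding total_degree_def
    using hyperedges_subset by (intro sum.cong refl) (simp add: Int_absorb2)
  also have "\<dots> = card (\<Union>(hyperedges H) \<inter> arrows H)"
    unfolding hyperedges_def by (rule sum_card_pieces_Int[OF subset_refl finite_arrows finite_arrows])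
  finally show ?thesis by (simp add: U)
qed

section \<open>Partial duals drawn at the ends of the original hypermap\<close>

context
  fixes A assumes A: "A \<subseteq> hyperedges H"
begin

private abbreviation "U \<equiv> \<Union>A"
private abbreviation "pos \<equiv> dual_pos H (\<Union>A)"

lemma Union_hyperedges_closed: "next_arrow H a \<in> U \<longleftrightarrow> a \<in> U" "U \<subseteq> arrows H"
  using A hyperedge_closed hyperedges_subset by blast+

lemma inv_closed: "inv (next_arrow H) a \<in> U \<longleftrightarrow> a \<in> U"
  using Union_hyperedges_closed(1)[of "inv (next_arrow H) a"] by simp

lemma bij_dual_pos: "bij pos"
proof (rule bijI)
  have nx: "next_arrow H a = next_arrow H b \<longleftrightarrow> a = b" for a b by (metis next_inv(2))
  show "inj pos"
  proof (rule injI)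
    fix x y assume "pos x = pos y"
    then show "x = y"
      by (cases x; cases y) (auto simp: nx Union_hyperedges_closed(1) simp del: Union_iff split: if_splits)
  qed
  show "surj pos"
  proof (rule surjI)
    fix x
    show "pos (if label x \<in> U then (case x of Head a \<Rightarrow> Tail a | Tail a \<Rightarrow> Head (inv (next_arrow H) a)) else x) = x"
      using inv_closed by (cases x) (auto simp del: Union_iff)
  qed
qed

lemma dual_pos_image: "pos ` ends H = ends H"
proof -
  have "finite (ends H)" using finite_arrows by (rule finite_ends_of)
  moreover have "pos x \<in> ends H" if "x \<in> ends H" for x
    using that by (cases x) (auto simp: in_ends_of_iff)
  then have "pos ` ends H \<subseteq> ends H" by blast
  moreover have "inj_on pos (ends H)" using bij_dual_pos by (meson bij_is_inj inj_on_subset subset_UNIV)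
  ultimately show ?thesis by (simp add: endo_inj_surj)
qed

text \<open>The conjugation in \<open>partial_dual\<close> cancels once every new end is placed at
  its old position by \<open>dual_pos\<close>.\<close>

lemma dual_arc_image: "map_prod pos pos ` arc_rel (partial_dual H A) = graph_on (ends H) (curve_arc H)"
proof -
  have "pos (inv pos x) = x" for x using bij_dual_pos by (simp add: bij_is_surj surj_f_inv_f)
  then have "map_prod pos pos ` arc_rel (partial_dual H A) = (\<lambda>x. (x, curve_arc H x)) ` pos ` ends H"
    by (simp add: arc_rel_def partial_dual_def setcompr_eq_image image_image)
  then show ?thesis unfolding dual_pos_image by (auto simp: graph_on_def)
qed

text \<open>For \<open>b\<close> in \<open>U\<close> the new arrow runs from \<open>Head b\<close>
  to \<open>Tail (next_arrow H b)\<close>, which is an old gap. Only the closures are compared,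
  since \<open>arrow_rel\<close> lists one direction and \<open>graph_on\<close> both.\<close>

lemma linked_dual_arrow:
  "linked (map_prod pos pos ` arrow_rel H)
    = linked (graph_on (ends H) (override_on other_end (gap_end H) (ends_of U)))"
  (is "linked ?R = linked (graph_on _ ?f)")
proof (rule linked_eqI)
  have mem: "(pos (Tail b), pos (Head b)) \<in> ?R" if "b \<in> arrows H" for b
    using that by (intro map_prod_imageI) (simp add: arrow_rel_def)
  have "(pos (Tail b), pos (Head b)) \<in> graph_on (ends H) ?f" if "b \<in> arrows H" for b
    using that by (simp add: graph_on_iff in_ends_of_iff override_on_def del: Union_iff)
  then have "?R \<subseteq> graph_on (ends H) ?f" unfolding arrow_rel_def by fastforce
  then show "?R \<subseteq> linked (graph_on (ends H) ?f)" using subset_linked by (rule order_trans)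
  show "graph_on (ends H) ?f \<subseteq> linked ?R"
  proof
    fix e assume "e \<in> graph_on (ends H) ?f"
    then obtain x where x: "label x \<in> arrows H" "e = (x, ?f x)" by (auto simp: graph_on_def in_ends_of_iff)
    show "e \<in> linked ?R"
    proof (cases x)
      case (Tail b)
      show ?thesis
      proof (cases "b \<in> U")
        case True
        have "(Head (inv (next_arrow H) b), Tail b) \<in> ?R"
          using mem[of "inv (next_arrow H) b"] x Tail True inv_closed by (simp del: Union_iff)
        then show ?thesis using x Tail True
          by (simp add: override_on_def in_ends_of_iff linked_sym[OF linked_edge] del: Union_iff)
      next
        case False
        then show ?thesis using mem[of b] x Tail
          by (simp add: override_on_def in_ends_of_iff linked_edge del: Union_iff)
      qed
    next
      case (Head b)
      show ?thesis
      proof (cases "b \<in> U")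
        case True
        then show ?thesis using mem[of b] x Head
          by (simp add: override_on_def in_ends_of_iff linked_edge del: Union_iff)
      next
        case False
        then show ?thesis using mem[of b] x Head
          by (simp add: override_on_def in_ends_of_iff linked_sym[OF linked_edge] del: Union_iff)
      qed
    qed
  qed
qed

text \<open>For \<open>b\<close> in \<open>U\<close> the gap after the new arrow \<open>b\<close>
  lies along the old arrow \<open>next_arrow H b\<close>.\<close>

lemma linked_dual_gap:
  "linked (map_prod pos pos ` gap_rel H)
    = linked (graph_on (ends H) (override_on (gap_end H) other_end (ends_of U)))"
  (is "linked ?R = linked (graph_on _ ?f)")
proof (rule linked_eqI)
  have mem: "(pos (Head b), pos (Tail (next_arrow H b))) \<in> ?R" if "b \<in> arrows H" for b
    using that by (intro map_prod_imageI) (simp add: gap_rel_def)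
  have "(pos (Head b), pos (Tail (next_arrow H b))) \<in> graph_on (ends H) ?f" if "b \<in> arrows H" for b
    using that Union_hyperedges_closed(1)
    by (simp add: graph_on_iff in_ends_of_iff override_on_def del: Union_iff)
  then have "?R \<subseteq> graph_on (ends H) ?f" unfolding gap_rel_def by fastforce
  then show "?R \<subseteq> linked (graph_on (ends H) ?f)" using subset_linked by (rule order_trans)
  show "graph_on (ends H) ?f \<subseteq> linked ?R"
  proof
    fix e assume "e \<in> graph_on (ends H) ?f"
    then obtain x where x: "label x \<in> arrows H" "e = (x, ?f x)" by (auto simp: graph_on_def in_ends_of_iff)
    \<comment> \<open>The gap after \<open>?c\<close> is the one ending at the tail of
      \<open>label x\<close>; in the dual it occupies the old arrow \<open>label x\<close> if that
      arrow is in \<open>U\<close>.\<close>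
    let ?c = "inv (next_arrow H) (label x)"
    show "e \<in> linked ?R"
    proof (cases x)
      case (Tail b)
      show ?thesis
      proof (cases "b \<in> U")
        case True
        then show ?thesis using mem[of ?c] x Tail inv_closed
          by (simp add: override_on_def in_ends_of_iff linked_edge del: Union_iff)
      next
        case False
        then show ?thesis using mem[of ?c] x Tail inv_closed
          by (simp add: override_on_def in_ends_of_iff linked_sym[OF linked_edge] del: Union_iff)
      qed
    next
      case (Head b)
      show ?thesis
      proof (cases "b \<in> U")
        case True
        then show ?thesis using mem[of ?c] x Head inv_closed
          by (simp add: override_on_def in_ends_of_iff linked_sym[OF linked_edge] del: Union_iff)
      next
        case False
        then show ?thesis using mem[of b] x Head Union_hyperedges_closed(1)
          by (simp add: override_on_def in_ends_of_iff linked_edge del: Union_iff)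
      qed
    qed
  qed
qed

lemma euler_genus_partial_dual:
  "euler_genus (partial_dual H A) =
     2 * int (card (pieces (ends H) (graph_on (ends H) (curve_arc H) \<union>
       (graph_on (ends H) other_end \<union> graph_on (ends H) (gap_end H)))))
     + int (card (arrows H))
     - int (cyc (ends H) (curve_arc H) (override_on other_end (gap_end H) (ends_of U)))
     - int (cyc (ends H) other_end (gap_end H))
     - int (cyc (ends H) (curve_arc H) (override_on (gap_end H) other_end (ends_of U)))"
proof -
  let ?K = "partial_dual H A" and ?X = "ends H"
  let ?a = "graph_on ?X (curve_arc H)"
  let ?t = "graph_on ?X (override_on other_end (gap_end H) (ends_of U))"
  let ?g = "graph_on ?X (override_on (gap_end H) other_end (ends_of U))"
  have K: "arrows ?K = arrows H" "hyperedges ?K = hyperedges H" "arrow_rel ?K = arrow_rel H"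
    "gap_rel ?K = gap_rel H" "bare_curves ?K = bare_curves H"
    by (simp_all add: partial_dual_def hyperedges_def arrow_rel_def gap_rel_def)
  have pull: "card (pieces ?X R) = card (pieces ?X S)" if "linked (map_prod pos pos ` R) = linked S" for R S
    using card_pieces_map[OF bij_dual_pos dual_pos_image, of R] pieces_cong[OF that] by simp
  have arc: "linked (map_prod pos pos ` arc_rel ?K) = linked ?a" by (simp add: dual_arc_image)
  have v: "card (pieces ?X (arrow_rel H \<union> arc_rel ?K)) = card (pieces ?X (?a \<union> ?t))"
    by (rule pull) (simp only: image_Un Un_commute[of "map_prod pos pos ` arrow_rel H"]
      linked_Un_cong[OF arc linked_dual_arrow])
  have f: "card (pieces ?X (arc_rel ?K \<union> gap_rel H)) = card (pieces ?X (?a \<union> ?g))"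
    by (rule pull) (simp only: image_Un linked_Un_cong[OF arc linked_dual_gap])
  have "card (pieces ?X (arrow_rel H \<union> arc_rel ?K \<union> gap_rel H)) = card (pieces ?X (?a \<union> ?t \<union> ?g))"
    by (rule pull) (simp only: image_Un Un_commute[of "map_prod pos pos ` arrow_rel H"]
      linked_Un_cong[OF linked_Un_cong[OF arc linked_dual_arrow] linked_dual_gap])
  \<comment> \<open>At each end the exchange only swaps the two kinds of edges, so connectivity does
    not depend on \<open>A\<close>.\<close>
  also have "?a \<union> ?t \<union> ?g = ?a \<union> (graph_on ?X other_end \<union> graph_on ?X (gap_end H))"
    by (auto simp: graph_on_def override_on_def)
  finally have k: "card (pieces ?X (arrow_rel H \<union> arc_rel ?K \<union> gap_rel H)) =
    card (pieces ?X (?a \<union> (graph_on ?X other_end \<union> graph_on ?X (gap_end H))))" .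
  have e: "num_hyperedges ?K = cyc ?X other_end (gap_end H)"
    using num_hyperedges_eq by (simp add: num_hyperedges_def K)
  have d: "total_degree ?K = card (arrows H)"
    using total_degree_eq by (simp add: total_degree_def K)
  show ?thesis
    unfolding euler_genus_def num_components_def num_hypervertices_def num_hyperfaces_def curves_def
      e d K v f k by simp
qed

end

lemma dual_pos_empty: "dual_pos H {} = id"
proof
  fix x :: "'a arrow_end" show "dual_pos H {} x = id x" by (cases x) simp_all
qed

lemma partial_dual_empty: "partial_dual H {} = H"
  by (simp add: partial_dual_def dual_pos_empty)

lemma num_components_eq:
  "num_components H = card (pieces (ends H) (graph_on (ends H) (curve_arc H) \<union>
     (graph_on (ends H) other_end \<union> graph_on (ends H) (gap_end H)))) + bare_curves H"
proof -
  let ?X = "ends H"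
  have "linked (arrow_rel H) = linked (graph_on ?X other_end)"
    "linked (gap_rel H) = linked (graph_on ?X (gap_end H))"
    using linked_dual_arrow[of "{}"] linked_dual_gap[of "{}"]
    by (simp_all add: dual_pos_empty ends_of_def map_prod.id)
  moreover have "arc_rel H = graph_on ?X (curve_arc H)" by (simp add: arc_rel_def graph_on_def)
  ultimately have "linked (arc_rel H \<union> (arrow_rel H \<union> gap_rel H)) =
      linked (graph_on ?X (curve_arc H) \<union> (graph_on ?X other_end \<union> graph_on ?X (gap_end H)))"
    by (intro linked_Un_cong) simp_all
  from pieces_cong[OF this] show ?thesis
    unfolding num_components_def by (simp only: Un_assoc Un_left_commute[of "arrow_rel H"])
qed

end

subsection \<open>One-vertex-joints\<close>

text \<open>Otherwise the path would be reversed by \<open>t\<close>, and its middle edge or vertex would be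
  fixed by \<open>a\<close> or \<open>t\<close>.\<close>

lemma alternating_path_not_reversed:
  assumes "matching X a" "matching X t" "w \<in> X"
  shows "((a \<circ> t) ^^ n) w \<noteq> t w"
  using assms(3)
proof (induction n arbitrary: w rule: less_induct)
  case (less n)
  have tw: "t w \<in> X" "t w \<noteq> w" "t (t w) = w" using less.prems assms(2) by (auto simp: matching_def)
  then have atw: "a (t w) \<in> X" "a (t w) \<noteq> t w" "a (a (t w)) = t w" using assms(1) by (auto simp: matching_def)
  show ?case
  proof
    assume eq: "((a \<circ> t) ^^ n) w = t w"
    obtain k where k: "n = Suc (Suc k)"
    proof (cases n)
      case 0
      then show ?thesis using eq tw by simp
    next
      case (Suc m)
      then show ?thesis using eq atw that by (cases m) auto
    qed
    let ?w = "(a \<circ> t) w" and ?u = "((a \<circ> t) ^^ k) ((a \<circ> t) w)"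
    have u: "?u \<in> X" using atw(1) by (induction k) (use assms in \<open>auto simp: matching_def\<close>)
    then have tu: "t ?u \<in> X" "t (t ?u) = ?u" using assms(2) by (auto simp: matching_def)
    then have "a (a (t ?u)) = t ?u" using assms(1) by (auto simp: matching_def)
    moreover have "(a \<circ> t) ?u = t w" using eq unfolding k by (simp add: funpow_swap1)
    ultimately have "t ?u = ?w" by simp
    then have "?u = t ?w" using tu(2) by simp
    moreover have "?u \<noteq> t ?w" by (rule less.IH) (use k atw(1) in simp_all)
    ultimately show False by simp
  qed
qed

context
  fixes H :: "'a arrow_presentation"
  assumes H: "ribbon_hypermap H"
begin

text \<open>The walk defining \<open>sub_arc\<close> can re-enter \<open>B\<close> only through an
  arc with an end outside \<open>B\<close>. Only \<open>x\<close> and \<open>x'\<close> can have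
  such arcs, and re-entering at \<open>x\<close> would reverse the walk.\<close>

lemma sub_arc_crossing:
  assumes B: "B \<subseteq> arrows H" and x: "x \<in> ends_of B" "curve_arc H x \<notin> ends_of B"
    and only: "\<And>z. z \<in> ends_of B \<Longrightarrow> z \<noteq> x \<Longrightarrow> z \<noteq> x' \<Longrightarrow> curve_arc H z \<in> ends_of B"
  shows "sub_arc H B x = x'"
proof -
  let ?a = "curve_arc H" and ?f = "curve_arc H \<circ> other_end"
  define w where "w = (\<lambda>n. (?f ^^ n) (?a x))"
  note ma = matching_curve_arc[OF H]
  note mt = matching_other_end[of "arrows H"]
  have X: "z \<in> ends_of B \<Longrightarrow> z \<in> ends H" for z using B by (auto simp: in_ends_of_iff)
  have a: "?a z \<in> ends H" "?a (?a z) = z" if "z \<in> ends H" for z using that ma by (auto simp: matching_def)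
  have w0: "?a x \<in> ends H" using a X x by blast
  have wX: "w n \<in> ends H" for n
    unfolding w_def using w0 by (induction n) (auto simp: in_ends_of_iff permutes_in_image[OF curve_arc_permutes[OF H], unfolded in_ends_of_iff])
  have w_Suc: "w (Suc n) = ?a (other_end (w n))" for n by (simp add: w_def)
  have "inj other_end" by (metis injI label_other_end(2))
  then have inj: "inj ?f" using permutes_inj[OF curve_arc_permutes[OF H]] by (rule inj_compose[rotated])
  \<comment> \<open>The walk is an orbit of an injection in a finite set, so it comes round to
    \<open>?a x\<close>. Just before that it is at \<open>other_end x\<close>, which lies in
    \<open>B\<close>; hence the \<open>LEAST\<close> exists.\<close>
  have "finite {y. \<exists>n. y = (?f ^^ n) (?a x)}"
    using finite_ends_of[OF finite_arrows[OF H]] by (rule rev_finite_subset) (use wX in \<open>auto simp: w_def\<close>)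
  then obtain N where N: "N > 0" "w N = ?a x" using funpow_inj_finite[OF inj] unfolding w_def by metis
  then obtain M where "N = Suc M" using gr0_implies_Suc by blast
  then have "?a (other_end (w M)) = ?a x" using N(2) w_Suc by simp
  then have "other_end (w M) = x" using permutes_inj[OF curve_arc_permutes[OF H]] by (simp add: inj_eq)
  then have "w M \<in> ends_of B" using x(1) by (metis in_ends_of_iff label_other_end(1))
  define n where "n = (LEAST n. w n \<in> ends_of B)"
  have n: "w n \<in> ends_of B" unfolding n_def by (rule LeastI) fact
  have "w 0 \<notin> ends_of B" using x(2) by (simp add: w_def)
  then have "n \<noteq> 0" using n by metis
  then obtain m where m: "n = Suc m" using not0_implies_Suc by blast
  have "w m \<notin> ends_of B" using m not_less_Least[of m "\<lambda>n. w n \<in> ends_of B"] unfolding n_def[symmetric] by simp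
  then have out: "other_end (w m) \<notin> ends_of B" by (simp add: in_ends_of_iff)
  have am: "?a (other_end (w m)) = w n" using m w_Suc by simp
  have "other_end (w m) \<in> ends H" using wX by (simp add: in_ends_of_iff)
  then have ret: "?a (w n) = other_end (w m)" using a(2) am by metis
  have "w n \<noteq> x"
  proof
    assume "w n = x"
    then have "other_end (w m) = ?a x" using ret by simp
    then have "w m = other_end (?a x)" by (metis label_other_end(2))
    then show False using alternating_path_not_reversed[OF ma mt w0, of m] by (simp add: w_def)
  qed
  then have "w n = x'" using only[OF n] ret out by metis
  then show ?thesis using x(1) unfolding sub_arc_def Let_def n_def w_def by simp
qed

lemma sub_arc_inside:
  assumes "z \<in> ends_of B" "curve_arc H z \<in> ends_of B"
  shows "sub_arc H B z = curve_arc H z"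
proof -
  have "(LEAST n. ((curve_arc H \<circ> other_end) ^^ n) (curve_arc H z) \<in> ends_of B) = 0"
    by (rule Least_eq_0) (use assms in simp)
  then show ?thesis using assms unfolding sub_arc_def Let_def by simp
qed

lemma Union_hyperedges_inside:
  assumes "B \<subseteq> arrows H" "\<And>a. next_arrow H a \<in> B \<longleftrightarrow> a \<in> B"
  shows "\<Union>{e \<in> hyperedges H. e \<subseteq> B} = B"
proof
  show "B \<subseteq> \<Union>{e \<in> hyperedges H. e \<subseteq> B}"
  proof
    let ?E = "{(a, next_arrow H a) | a. a \<in> arrows H}"
    fix b assume b: "b \<in> B"
    have "class_of ?E b \<subseteq> B"
    proof
      fix c assume "c \<in> class_of ?E b"
      then have "(b, c) \<in> linked ?E" by (simp add: class_of_def)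
      then show "c \<in> B" by (rule linked_closed) (use b assms(2) in auto)
    qed
    moreover have "class_of ?E b \<in> hyperedges H"
      using b assms(1) unfolding hyperedges_def pieces_class_of by blast
    ultimately show "b \<in> \<Union>{e \<in> hyperedges H. e \<subseteq> B}" using self_in_class_of[of b ?E] by blast
  qed
qed blast

text \<open>Cutting the two arcs and joining the loose ends on each side gives two summands. Pasting
  them along the new arcs from \<open>x\<close> to \<open>x'\<close> and from \<open>y\<close> to
  \<open>y'\<close> restores the old arcs.\<close>

lemma not_prime_if_two_arc_cut:
  assumes bare: "bare_curves H = 0"
    and C: "C \<subseteq> ends H" "matching C other_end" "matching C (gap_end H)"
    and y: "y \<in> C" "y' \<in> C" "y \<noteq> y'" "curve_arc H y \<notin> C" "curve_arc H y' \<notin> C"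
    and only: "\<And>z. z \<in> C \<Longrightarrow> z \<noteq> y \<Longrightarrow> z \<noteq> y' \<Longrightarrow> curve_arc H z \<in> C"
  shows "\<not> prime_hypermap H"
proof -
  let ?a = "curve_arc H"
  define B2 where "B2 = {b \<in> arrows H. Tail b \<in> C}"
  define B1 where "B1 = arrows H - B2"
  have t: "other_end z \<in> C \<longleftrightarrow> z \<in> C" for z
    using C(2) by (metis label_other_end(2) matching_def)
  have CB: "C = ends_of B2"
  proof (intro set_eqI)
    fix z show "z \<in> C \<longleftrightarrow> z \<in> ends_of B2"
      using C(1) t[of z] by (cases z) (auto simp: B2_def in_ends_of_iff)
  qed
  have ends: "ends H = ends_of B1 \<union> ends_of B2" "ends_of B1 \<inter> ends_of B2 = {}"
    using C(1) by (auto simp: B1_def B2_def in_ends_of_iff)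
  have sub: "B1 \<subseteq> arrows H" "B2 \<subseteq> arrows H" by (auto simp: B1_def B2_def)
  have gap: "gap_end H z \<in> C" if "z \<in> C" for z using that C(3) by (simp add: matching_def)
  have B2: "next_arrow H b \<in> B2 \<longleftrightarrow> b \<in> B2" for b
  proof -
    have "next_arrow H b \<in> B2" if "b \<in> B2" for b
    proof -
      have "gap_end H (Head b) \<in> C" using that by (intro gap) (simp add: CB in_ends_of_iff)
      then show ?thesis by (simp add: CB in_ends_of_iff)
    qed
    moreover have "b \<in> B2" if "next_arrow H b \<in> B2"
    proof -
      have "gap_end H (Tail (next_arrow H b)) \<in> C" using that by (intro gap) (simp add: CB in_ends_of_iff)
      then show ?thesis by (simp add: CB in_ends_of_iff next_inv[OF H])
    qed
    ultimately show ?thesis by blast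
  qed
  have B1: "next_arrow H b \<in> B1 \<longleftrightarrow> b \<in> B1" for b
    using B2 by (simp add: B1_def next_in_arrows[OF H])
  have a: "?a z \<in> ends H" "?a (?a z) = z" if "z \<in> ends H" for z
    using that matching_curve_arc[OF H] by (auto simp: matching_def)
  have yX: "y \<in> ends H" "y' \<in> ends H" using y C(1) by auto
  define x where "x = ?a y"
  define x' where "x' = ?a y'"
  have ax: "?a x = y" "?a x' = y'" "x \<noteq> x'" using a yX y(3) unfolding x_def x'_def by metis+
  have x: "x \<in> ends_of B1" "x' \<in> ends_of B1" "y \<in> ends_of B2" "y' \<in> ends_of B2"
    using a(1)[OF yX(1)] a(1)[OF yX(2)] y ends(1) CB unfolding x_def x'_def by auto
  have only2: "?a z \<in> ends_of B2" if "z \<in> ends_of B2" "z \<noteq> y" "z \<noteq> y'" for z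
    using only that CB by simp
  have only1: "?a z \<in> ends_of B1" if z: "z \<in> ends_of B1" "z \<noteq> x" "z \<noteq> x'" for z
  proof (rule ccontr)
    assume "?a z \<notin> ends_of B1"
    moreover have zX: "z \<in> ends H" using z(1) ends(1) by blast
    ultimately have az: "?a z \<in> ends_of B2" using a(1)[OF zX] ends(1) by blast
    have "?a (?a z) \<notin> ends_of B2" using a(2)[OF zX] z(1) ends(2) by auto
    then have "?a z = y \<or> ?a z = y'" using only2[OF az] by blast
    then show False using a(2)[OF zX] z(2,3) unfolding x_def x'_def by metis
  qed
  have "sub_arc H B1 x = x'"
    by (rule sub_arc_crossing[OF sub(1) x(1) _ only1]) (use ax x ends(2) in auto)
  moreover have "sub_arc H B2 y = y'"
    by (rule sub_arc_crossing[OF sub(2) x(3) _ only2]) (use x ends(2) in \<open>auto simp: x_def\<close>)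
  moreover have "sub_arc H B1 z = ?a z" if "z \<in> ends_of B1" "z \<noteq> x" "z \<noteq> x'" for z
    by (rule sub_arc_inside[OF that(1) only1[OF that]])
  moreover have "sub_arc H B2 z = ?a z" if "z \<in> ends_of B2" "z \<noteq> y" "z \<noteq> y'" for z
    by (rule sub_arc_inside[OF that(1) only2[OF that]])
  \<comment> \<open>Outside both carriers \<open>joint\<close> falls through to the second summand,
    and equality of records also compares these values.\<close>
  moreover have "sub_arc H B2 z = ?a z" if "z \<notin> ends H" for z
    using that ends(1) permutes_not_in[OF curve_arc_permutes[OF H] that] by (simp add: sub_arc_def Let_def)
  ultimately have sub_arc: "sub_arc H B1 x = x'" "sub_arc H B2 y = y'"
    "\<And>z. z \<in> ends_of B1 \<Longrightarrow> z \<noteq> x \<Longrightarrow> z \<noteq> x' \<Longrightarrow> sub_arc H B1 z = ?a z"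
    "\<And>z. z \<in> ends_of B2 \<Longrightarrow> z \<noteq> y \<Longrightarrow> z \<noteq> y' \<Longrightarrow> sub_arc H B2 z = ?a z"
    "\<And>z. z \<notin> ends H \<Longrightarrow> sub_arc H B2 z = ?a z" by blast+
  \<comment> \<open>Bare hypervertices produced by the deletion are discarded; kept, they would be
    counted as bare hypervertices of the joint.\<close>
  define part where "part = (\<lambda>B. (delete_outside H {e \<in> hyperedges H. e \<subseteq> B})\<lparr>bare_curves := 0\<rparr>)"
  have part: "arrows (part B) = B" "next_arrow (part B) = (\<lambda>b. if b \<in> B then next_arrow H b else b)"
    "curve_arc (part B) = sub_arc H B" "bare_curves (part B) = 0" if "B = B1 \<or> B = B2" for B
  proof -
    have "\<Union>{e \<in> hyperedges H. e \<subseteq> B} = B"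
      using that sub B1 B2 by (intro Union_hyperedges_inside) auto
    then show "arrows (part B) = B" "next_arrow (part B) = (\<lambda>b. if b \<in> B then next_arrow H b else b)"
      "curve_arc (part B) = sub_arc H B" "bare_curves (part B) = 0"
      unfolding part_def delete_outside_def by simp_all
  qed
  have "joint (part B1) (part B2) x y = H"
  proof (rule arrow_presentation.equality)
    show "arrows (joint (part B1) (part B2) x y) = arrows H"
      using sub by (auto simp: joint_def Let_def part B1_def)
    show "next_arrow (joint (part B1) (part B2) x y) = next_arrow H"
    proof
      fix b
      have "next_arrow H b = b" if "b \<notin> B1" "b \<notin> B2"
        using that by (intro permutes_not_in[OF next_permutes[OF H]]) (simp add: B1_def)
      then show "next_arrow (joint (part B1) (part B2) x y) b = next_arrow H b"
        by (simp add: joint_def Let_def part)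
    qed
    show "curve_arc (joint (part B1) (part B2) x y) = curve_arc H"
    proof
      fix z
      have J: "curve_arc (joint (part B1) (part B2) x y) =
        (\<lambda>z. if z \<in> ends_of B1 then sub_arc H B1 z else sub_arc H B2 z) (x := y, y := x, x' := y', y' := x')"
        by (simp add: joint_def Let_def part sub_arc(1,2) cong del: if_weak_cong)
      have ne: "x \<noteq> y" "x \<noteq> y'" "x' \<noteq> y" "x' \<noteq> y'" using x ends(2) by auto
      show "curve_arc (joint (part B1) (part B2) x y) z = curve_arc H z"
      proof (cases "z \<in> {x, x', y, y'}")
        case True
        then show ?thesis using ne ax y(3) unfolding J x_def[symmetric] x'_def[symmetric]
          by (auto simp: x_def[symmetric] x'_def[symmetric])
      next
        case False
        then show ?thesis using sub_arc(3-5)[of z] ends unfolding J by auto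
      qed
    qed
  qed (simp_all add: joint_def Let_def part bare)
  moreover have "ends (part B1) = ends_of B1" "ends (part B2) = ends_of B2"
    "arrows (part B1) \<inter> arrows (part B2) = {}" by (auto simp: part B1_def)
  ultimately have "one_vertex_joint (part B1) (part B2) H"
    unfolding one_vertex_joint_def using x(1,3) by metis
  then have "iterated_joint ([part B1] @ [part B2]) H" by (rule iterated_joint.snoc[OF iterated_joint.single])
  moreover have "sub_hypermap (part B) H" for B
    unfolding sub_hypermap_def part_def by (intro exI[of _ "{e \<in> hyperedges H. e \<subseteq> B}"] exI[of _ 0]) auto
  moreover have "hyperedges (part B1) \<noteq> {}" "hyperedges (part B2) \<noteq> {}"
    using x(1,3) by (auto simp: hyperedges_def pieces_class_of part in_ends_of_iff)
  ultimately have "\<exists>Hs. length Hs \<ge> 2 \<and> (\<forall>K\<in>set Hs. sub_hypermap K H \<and> hyperedges K \<noteq> {}) \<and> iterated_joint Hs H"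
    by (intro exI[of _ "[part B1] @ [part B2]"]) simp
  then show ?thesis unfolding prime_hypermap_def by (simp only: not_not)
qed

end

text \<open>All coefficients are 1, so the coefficient at a positive degree counts its occurrences
  and nothing cancels.\<close>

lemma sum_monom_eq_const_iff:
  assumes "finite S"
  shows "(\<exists>k :: int. (\<Sum>s\<in>S. monom 1 (f s)) = [:k:]) \<longleftrightarrow> (\<forall>s\<in>S. f s = (0 :: nat))"
proof
  assume "\<exists>k :: int. (\<Sum>s\<in>S. monom 1 (f s)) = [:k:]"
  then obtain k :: int where k: "(\<Sum>s\<in>S. monom 1 (f s)) = [:k:]" by blast
  show "\<forall>s\<in>S. f s = 0"
  proof (rule ccontr)
    assume "\<not> (\<forall>s\<in>S. f s = 0)"
    then obtain s where s: "s \<in> S" "f s \<noteq> 0" by blast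
    have "coeff [:k:] (f s) = (\<Sum>r\<in>S. if f r = f s then 1 else 0)"
      unfolding k[symmetric] coeff_sum by (simp add: eq_commute)
    moreover have "coeff [:k:] (f s) = 0" using s(2) by (cases "f s") simp_all
    ultimately have "(\<Sum>r\<in>S. if f r = f s then 1 else 0 :: int) = 0" by simp
    then have "(if f s = f s then 1 else 0 :: int) = 0"
      using assms s(1) by (subst (asm) sum_nonneg_eq_0_iff) auto
    then show False by simp
  qed
next
  assume "\<forall>s\<in>S. f s = 0"
  then have "(\<Sum>s\<in>S. monom 1 (f s)) = [:int (card S):]"
    by (simp add: monom_0 of_nat_poly)
  then show "\<exists>k :: int. (\<Sum>s\<in>S. monom 1 (f s)) = [:k:]" by blast
qed

theorem theorem4p8:
  fixes H :: "'a arrow_presentation"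
  assumes "ribbon_hypermap H"
    and "hyperedges H \<noteq> {}"
    and "connected_hypermap H"
    and "prime_hypermap H"
  shows "(\<exists>k :: int. partial_dual_polynomial H = [:k:]) \<longleftrightarrow>
         plane_hypermap H \<and> num_hyperedges H = 1"
proof -
  let ?X = "ends H" and ?a = "curve_arc H" and ?g = "gap_end H"
  let ?R = "graph_on ?X ?a \<union> (graph_on ?X other_end \<union> graph_on ?X ?g)"
  have arr: "arrows H \<noteq> {}" using assms(2) by (auto simp: hyperedges_def pieces_class_of)
  have fin: "finite (arrows H)" "finite ?X" using finite_arrows[OF assms(1)] finite_ends_of by auto
  have fin_e: "finite (hyperedges H)" using fin by (simp add: hyperedges_def)
  have card_X: "card ?X = 2 * card (arrows H)" by (rule card_ends_of[OF fin(1)])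
  have match: "matching ?X ?a" "matching ?X other_end" "matching ?X ?g"
    using matching_curve_arc[OF assms(1)] matching_other_end matching_gap_end[OF assms(1)]
      next_in_arrows[OF assms(1)] by auto
  have "pieces ?X S \<noteq> {}" for S using arr by (auto simp: pieces_class_of ends_of_def)
  then have "card (pieces ?X ?R) > 0" using fin(2) by (simp add: card_gt_0_iff)
  \<comment> \<open>The arrow ends already form a component, so a connected hypermap has no room for
    a bare hypervertex.\<close>
  then have bare: "bare_curves H = 0"
    using assms(3) num_components_eq[OF assms(1)] by (simp add: connected_hypermap_def)
  have conn: "card (pieces ?X ?R) = 1"
    using assms(3) bare num_components_eq[OF assms(1)] by (simp add: connected_hypermap_def)
  have genus: "euler_genus (partial_dual H A) = 2 + int (card (arrows H)) - int (cyc ?X other_end ?g)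
      - int (cyc ?X ?a (override_on other_end ?g (ends_of (\<Union>A))))
      - int (cyc ?X ?a (override_on ?g other_end (ends_of (\<Union>A))))" if "A \<subseteq> hyperedges H" for A
    using euler_genus_partial_dual[OF assms(1) that] conn by simp
  have genus_H: "euler_genus H = 2 + int (card (arrows H)) - int (cyc ?X other_end ?g)
      - int (cyc ?X ?a other_end) - int (cyc ?X ?a ?g)"
    using genus[of "{}"] by (simp add: partial_dual_empty[OF assms(1)] ends_of_def)
  have nonneg: "0 \<le> euler_genus H"
    using euler_inequality[OF fin(2) match] conn card_X genus_H by simp
  have const: "(\<exists>k :: int. partial_dual_polynomial H = [:k:]) \<longleftrightarrow>
      (\<forall>A\<in>Pow (hyperedges H). nat (euler_genus (partial_dual H A)) = 0)"
    unfolding partial_dual_polynomial_def using fin_e by (intro sum_monom_eq_const_iff) simp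
  show ?thesis
  proof
    assume "\<exists>k :: int. partial_dual_polynomial H = [:k:]"
    \<comment> \<open>Through \<open>nat\<close> the polynomial yields only this upper bound, which
      is the direction that the cut argument uses.\<close>
    then have le0: "euler_genus (partial_dual H A) \<le> 0" if "A \<subseteq> hyperedges H" for A
      using const that by simp
    have H0: "euler_genus H \<le> 0" using le0[of "{}"] by (simp add: partial_dual_empty[OF assms(1)])
    have "num_hyperedges H = 1"
    proof (rule ccontr)
      assume "num_hyperedges H \<noteq> 1"
      obtain e where e: "e \<in> hyperedges H" using assms(2) by blast
      have "hyperedges H \<noteq> {e}" using \<open>num_hyperedges H \<noteq> 1\<close> by (auto simp: num_hyperedges_def)
      then obtain e' where e': "e' \<in> hyperedges H" "e' \<noteq> e" using e by blast
      let ?Y = "ends_of e"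
      have Y: "?Y \<in> pieces ?X (graph_on ?X other_end \<union> graph_on ?X ?g)"
        using e by (simp add: pieces_arrow_gap[OF assms(1)])
      have YX: "?Y \<subseteq> ?X" "?Y \<noteq> {}"
        using hyperedges_subset[OF assms(1) e] piece_nonempty[OF Y] by (auto simp: in_ends_of_iff)
      have "e \<inter> e' = {}"
        using pieces_disjoint[OF e[unfolded hyperedges_def] e'(1)[unfolded hyperedges_def]] e'(2) by blast
      moreover have "e' \<noteq> {}" "e' \<subseteq> arrows H"
        using piece_nonempty[OF e'(1)[unfolded hyperedges_def]] hyperedges_subset[OF assms(1) e'(1)] by auto
      ultimately have "e \<noteq> arrows H" by blast
      then have "?Y \<noteq> ?X" using injD[OF inj_ends_of, of e "arrows H"] by blast
      have mY: "matching ?Y other_end" "matching ?Y ?g"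
        using matching_other_end matching_gap_end[OF assms(1) hyperedge_closed[OF assms(1) e]] by auto
      have linked: "(x, y) \<in> linked (graph_on ?X other_end \<union> graph_on ?X ?g)"
        if xy: "x \<in> ?Y" "y \<in> ?Y" for x y
        using piece_eq_class_of[OF Y xy(1)] xy(2) by (simp add: class_of_def)
      have plane: "card ?X + 4 \<le> 2 * (cyc ?X ?a other_end + cyc ?X ?a ?g + cyc ?X other_end ?g)"
        using H0 genus_H card_X by simp
      have plane': "card ?X + 4 \<le> 2 * (cyc ?X ?a (override_on other_end ?g ?Y)
          + cyc ?X ?a (override_on ?g other_end ?Y) + cyc ?X other_end ?g)"
        using le0[of "{e}"] genus[of "{e}"] e card_X by simp
      from exists_two_arc_cut[OF fin(2) match YX \<open>?Y \<noteq> ?X\<close> mY linked conn plane plane']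
      obtain C y y' where C: "C \<subseteq> ?X - ?Y" "matching C other_end" "matching C ?g" "y \<in> C" "y' \<in> C" "y \<noteq> y'"
        "?a y \<notin> C" "?a y' \<notin> C" "\<And>z. z \<in> C \<Longrightarrow> z \<noteq> y \<Longrightarrow> z \<noteq> y' \<Longrightarrow> ?a z \<in> C" by blast
      have "C \<subseteq> ?X" using C(1) by blast
      from not_prime_if_two_arc_cut[OF assms(1) bare this C(2-9)] show False using assms(4) by simp
    qed
    then show "plane_hypermap H \<and> num_hyperedges H = 1"
      using H0 nonneg assms(3) by (simp add: plane_hypermap_def)
  next
    assume plane: "plane_hypermap H \<and> num_hyperedges H = 1"
    then obtain e where e: "hyperedges H = {e}"
      unfolding num_hyperedges_def by (metis card_1_singletonE)
    have "\<Union>(hyperedges H) = arrows H" unfolding hyperedges_def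
      by (rule Union_pieces) (auto simp: next_in_arrows[OF assms(1)])
    then have e_eq: "e = arrows H" using e by simp
    have "euler_genus (partial_dual H {}) = 0"
      using plane by (simp add: partial_dual_empty[OF assms(1)] plane_hypermap_def)
    \<comment> \<open>With a single hyperedge the exchange swaps arrows and gaps everywhere, so
      hypervertices and hyperfaces trade places and the genus stays.\<close>
    moreover have "euler_genus (partial_dual H {e}) = 0"
    proof -
      have "graph_on ?X (override_on f h ?X) = graph_on ?X h" for f h :: "'a arrow_end \<Rightarrow> 'a arrow_end"
        by (auto simp: graph_on_def)
      then show ?thesis
        using genus[of "{e}"] genus_H plane by (simp add: e e_eq plane_hypermap_def)
    qed
    moreover have "Pow (hyperedges H) = {{}, {e}}" using e by auto
    ultimately show "\<exists>k :: int. partial_dual_polynomial H = [:k:]" unfolding const by simp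
  qed
qed

end
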